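(* Let $S$ be a nonempty set and let $G$ be a group of permutations of $S$. The twisted Brin–Thompson group $SV_G$ is finitely generated if and only if $G$ is finitely generated and the action of $G$ on $S$ has finitely many orbits.
   Context: Let $\mathfrak C=\{0,1\}^{\omega}$ be the Cantor set, $S$ a nonempty set, and $G$ a subgroup of the symmetric group of $S$ (so $G$ acts faithfully on $S$). Let $\mathfrak C^S$ be the space of all functions $S\to\mathfrak C$ with the product topology. For a function $\psi\colon S\to\{0,1\}^*$ (finite binary words, $\varnothing$ the empty word) with $\psi(s)=\varnothing$ for all but finitely many $s$, the dyadic brick $B(\psi)$ is the set of $\kappa\in\mathfrak C^S$ such that $\psi(s)$ is a prefix of $\kappa(s)$ for all $s\in S$; the canonical homeomorphism $\Phi_\psi\colon\mathfrak C^S\to B(\psi)$ is $\Phi_\psi(\kappa)(s)=\psi(s)\cdot\kappa(s)$ (concatenation). For $\gamma\in G$ let $\tau_\gamma\colon\mathfrak C^S\to\mathfrak C^S$ be $\tau_\gamma(\kappa)(s)=\kappa(\gamma^{-1}s)$. The twist homeomorphism $B(\varphi)\to B(\psi)$ associated to $\gamma$ is $\Phi_\psi\circ\tau_\gamma\circ\Phi_\varphi^{-1}$. The twisted Brin–Thompson group $SV_G$ is the group of all homeomorphisms $h$ of $\mathfrak C^S$ for which there exist two partitions $B(\varphi_1),\dots,B(\varphi_n)$ and $B(\psi_1),\dots,B(\psi_n)$ of $\mathfrak C^S$ into dyadic bricks and elements $\gamma_1,\dots,\gamma_n\in G$ such that $h$ restricted to $B(\varphi_i)$ is the twist homeomorphism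 $B(\varphi_i)\to B(\psi_i)$ associated to $\gamma_i$, for each $i$. *)

theory Defs
  imports "HOL-Analysis.Analysis" "HOL-Algebra.Bij" "HOL-Algebra.Generated_Groups"
begin

type_synonym cantor = "nat \<Rightarrow> bool"

definition cantor_top :: "cantor topology" where
  "cantor_top = product_topology (\<lambda>_. discrete_topology (UNIV :: bool set)) UNIV"

text \<open>The space C^S, S being the universe of the type 's, with the product topology.\<close>
definition cantorS_top :: "('s \<Rightarrow> cantor) topology" where
  "cantorS_top = product_topology (\<lambda>_. cantor_top) UNIV"

definition wcat :: "bool list \<Rightarrow> cantor \<Rightarrow> cantor" where
  "wcat w x = (\<lambda>i. if i < length w then w ! i else x (i - length w))"

definition wprefix :: "bool list \<Rightarrow> cantor \<Rightarrow> bool" where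
  "wprefix w x \<longleftrightarrow> (\<forall>i < length w. x i = w ! i)"

definition brick_label :: "('s \<Rightarrow> bool list) \<Rightarrow> bool" where
  "brick_label \<psi> \<longleftrightarrow> finite {s. \<psi> s \<noteq> []}"

definition brick :: "('s \<Rightarrow> bool list) \<Rightarrow> ('s \<Rightarrow> cantor) set" where
  "brick \<psi> = {\<kappa>. \<forall>s. wprefix (\<psi> s) (\<kappa> s)}"

definition Phi :: "('s \<Rightarrow> bool list) \<Rightarrow> ('s \<Rightarrow> cantor) \<Rightarrow> ('s \<Rightarrow> cantor)" where
  "Phi \<psi> \<kappa> = (\<lambda>s. wcat (\<psi> s) (\<kappa> s))"

text \<open>Inverse of Phi on the brick: drop the prefix.\<close>
definition Phi_inv :: "('s \<Rightarrow> bool list) \<Rightarrow> ('s \<Rightarrow> cantor) \<Rightarrow> ('s \<Rightarrow> cantor)" where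
  "Phi_inv \<psi> \<kappa> = (\<lambda>s i. \<kappa> s (i + length (\<psi> s)))"

definition tau :: "('s \<Rightarrow> 's) \<Rightarrow> ('s \<Rightarrow> cantor) \<Rightarrow> ('s \<Rightarrow> cantor)" where
  "tau \<gamma> \<kappa> = (\<lambda>s. \<kappa> (inv_into UNIV \<gamma> s))"

definition twist :: "('s \<Rightarrow> bool list) \<Rightarrow> ('s \<Rightarrow> bool list) \<Rightarrow> ('s \<Rightarrow> 's)
    \<Rightarrow> ('s \<Rightarrow> cantor) \<Rightarrow> ('s \<Rightarrow> cantor)" where
  "twist \<phi> \<psi> \<gamma> = Phi \<psi> \<circ> tau \<gamma> \<circ> Phi_inv \<phi>"

definition brick_partition :: "nat \<Rightarrow> (nat \<Rightarrow> 's \<Rightarrow> bool list) \<Rightarrow> bool" where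
  "brick_partition n \<phi> \<longleftrightarrow>
     (\<forall>i<n. brick_label (\<phi> i)) \<and>
     (\<forall>i<n. \<forall>j<n. i \<noteq> j \<longrightarrow> brick (\<phi> i) \<inter> brick (\<phi> j) = {}) \<and>
     (\<Union>i<n. brick (\<phi> i)) = UNIV"

definition SV :: "('s \<Rightarrow> 's) set \<Rightarrow> (('s \<Rightarrow> cantor) \<Rightarrow> ('s \<Rightarrow> cantor)) set" where
  "SV G = {h. homeomorphic_map cantorS_top cantorS_top h \<and>
     (\<exists>n \<phi> \<psi> \<gamma>. brick_partition n \<phi> \<and> brick_partition n \<psi> \<and> (\<forall>i<n. \<gamma> i \<in> G) \<and>
        (\<forall>i<n. \<forall>\<kappa>\<in>brick (\<phi> i). h \<kappa> = twist (\<phi> i) (\<psi> i) (\<gamma> i) \<kappa>))}"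

definition fin_gen_perm :: "('a \<Rightarrow> 'a) set \<Rightarrow> bool" where
  "fin_gen_perm H \<longleftrightarrow> (\<exists>F. finite F \<and> F \<subseteq> H \<and> generate (BijGroup (UNIV :: 'a set)) F = H)"

definition orbits :: "('s \<Rightarrow> 's) set \<Rightarrow> 's set set" where
  "orbits G = (\<lambda>s. {g s | g. g \<in> G}) ` UNIV"

end

theory Submission
  imports Defs "HOL-Combinatorics.Permutations"
begin

text \<open>
  Necessity. The permutations \<open>\<gamma>\<close> occurring in finitely many generators of \<open>SV G\<close> generate a subgroup
  \<open>G'\<close> of \<open>G\<close> with \<open>SV G' = SV G\<close>. As the permutation of a twist is determined by its restriction to any
  brick, \<open>G' = G\<close>. On an orbit avoiding all coordinates which the labels of the generators involve,
  every element would only permute coordinates, whereas \<open>SV G\<close> contains flips of the first bit.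

  Sufficiency. Fix a coordinate \<open>r\<close>. Global permutations, baker maps from orbit representatives to \<open>r\<close>,
  a few swaps at coordinate \<open>r\<close>, and copies of all these on the half cube \<open>h0\<close> at \<open>r\<close> move every
  proper brick canonically to \<open>h0\<close>: a permutation brings a letter of the label to an orbit
  representative, a baker map shifts this letter to \<open>r\<close>, and there it is absorbed. Because the copies permute
  coordinates while keeping \<open>h0\<close>, finitely many orbits on coordinates suffice; orbits on pairs of
  coordinates play no role. Adding one more level of copies yields all swaps of disjoint
  bricks, all local permutations and all local baker maps. Any two partitions
  obtained from the whole space by the same number of halvings are then equivalent, by induction on this
  number, and every element of \<open>SV G\<close> matches two such partitions.
\<close>

section \<open>Permutation groups as sets of functions\<close>

abbreviation finv :: "('a \<Rightarrow> 'a) \<Rightarrow> 'a \<Rightarrow> 'a" where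
  "finv \<equiv> inv_into UNIV"

text \<open>Subgroups of the full symmetric group, phrased with plain composition and inverse, which
  keeps the restricted operations of \<open>BijGroup\<close> out of later arguments.\<close>

definition perm_group :: "('a \<Rightarrow> 'a) set \<Rightarrow> bool" where
  "perm_group H \<longleftrightarrow> id \<in> H \<and> (\<forall>f\<in>H. bij f \<and> finv f \<in> H) \<and> (\<forall>f\<in>H. \<forall>g\<in>H. f \<circ> g \<in> H)"

abbreviation gen :: "('a \<Rightarrow> 'a) set \<Rightarrow> ('a \<Rightarrow> 'a) set" where
  "gen \<equiv> generate (BijGroup UNIV)"

lemma Bij_UNIV: "Bij UNIV = Collect bij"
  by (auto simp: Bij_def)

lemma mult_BijGroup_UNIV:
  "bij f \<Longrightarrow> bij g \<Longrightarrow> f \<otimes>\<^bsub>BijGroup UNIV\<^esub> g = f \<circ> g"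
  by (simp add: BijGroup_def Bij_UNIV compose_def fun_eq_iff)

lemma inv_BijGroup_UNIV: "bij f \<Longrightarrow> inv\<^bsub>BijGroup UNIV\<^esub> f = finv f"
  using inv_BijGroup[of f UNIV] by (simp add: Bij_UNIV fun_eq_iff)

lemma one_BijGroup_UNIV: "\<one>\<^bsub>BijGroup UNIV\<^esub> = id"
  by (simp add: BijGroup_def fun_eq_iff)

lemma carrier_BijGroup_UNIV: "carrier (BijGroup UNIV) = Collect bij"
  by (simp add: BijGroup_def Bij_UNIV)

lemmas BijGroup_UNIV =
  inv_BijGroup_UNIV mult_BijGroup_UNIV one_BijGroup_UNIV carrier_BijGroup_UNIV

lemma subgroup_BijGroup_iff: "subgroup H (BijGroup UNIV) \<longleftrightarrow> perm_group H"
proof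
  assume H: "subgroup H (BijGroup UNIV)"
  have b: "bij f" if "f \<in> H" for f
    using subgroup.subset[OF H] that by (auto simp: BijGroup_UNIV)
  show "perm_group H"
    unfolding perm_group_def
    using subgroup.one_closed[OF H] subgroup.m_inv_closed[OF H] subgroup.m_closed[OF H] b
    by (metis BijGroup_UNIV(1-3))
next
  assume H: "perm_group H"
  then show "subgroup H (BijGroup UNIV)"
    by unfold_locales (auto simp: perm_group_def BijGroup_UNIV)
qed

lemma perm_group_gen: "A \<subseteq> Collect bij \<Longrightarrow> perm_group (gen A)"
  using group.generate_is_subgroup[OF group_BijGroup, of A UNIV] subgroup_BijGroup_iff
  by (auto simp: BijGroup_UNIV)

lemma gen_subset: "perm_group H \<Longrightarrow> A \<subseteq> H \<Longrightarrow> gen A \<subseteq> H"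
  using group.generate_subgroup_incl[OF group_BijGroup, of A H] subgroup_BijGroup_iff
  by auto

lemma subset_gen: "A \<subseteq> gen A"
  by (auto intro: generate.incl)

lemma perm_groupD:
  assumes "perm_group H"
  shows perm_group_id: "id \<in> H"
    and perm_group_bij: "f \<in> H \<Longrightarrow> bij f"
    and perm_group_inv: "f \<in> H \<Longrightarrow> finv f \<in> H"
    and perm_group_comp: "f \<in> H \<Longrightarrow> g \<in> H \<Longrightarrow> f \<circ> g \<in> H"
  using assms by (auto simp: perm_group_def)

lemma bij_finv [simp]:
  assumes "bij f"
  shows "finv f (f x) = x" and "f (finv f x) = x" and "bij (finv f)" and "finv (finv f) = f"
  using assms by (simp_all add: bij_is_inj bij_is_surj surj_f_inv_f bij_imp_bij_inv inv_inv_eq)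

lemma finv_eq_iff: "bij f \<Longrightarrow> finv f x = y \<longleftrightarrow> x = f y"
  by auto

section \<open>Labels and bricks\<close>

text \<open>Labels of subbricks: the composite of the canonical maps of \<phi> and \<alpha> is the
  canonical map of \<open>lcat \<phi> \<alpha>\<close>.\<close>

definition lcat :: "('s \<Rightarrow> bool list) \<Rightarrow> ('s \<Rightarrow> bool list) \<Rightarrow> 's \<Rightarrow> bool list" where
  "lcat \<phi> \<alpha> = (\<lambda>s. \<phi> s @ \<alpha> s)"

text \<open>The action on labels for which \<open>tau \<gamma>\<close> carries
  \<open>brick \<alpha>\<close> onto \<open>brick (lact \<gamma> \<alpha>)\<close> when \<gamma> is
  bijective.\<close>

definition lact :: "('s \<Rightarrow> 's) \<Rightarrow> ('s \<Rightarrow> bool list) \<Rightarrow> 's \<Rightarrow> bool list" where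
  "lact \<gamma> \<alpha> = (\<lambda>s. \<alpha> (finv \<gamma> s))"

definition single :: "'s \<Rightarrow> bool list \<Rightarrow> 's \<Rightarrow> bool list" where
  "single s w = (\<lambda>t. if t = s then w else [])"

abbreviation lnil :: "'s \<Rightarrow> bool list" where
  "lnil \<equiv> (\<lambda>_. [])"

abbreviation ext :: "('s \<Rightarrow> bool list) \<Rightarrow> 's \<Rightarrow> bool \<Rightarrow> 's \<Rightarrow> bool list" where
  "ext \<phi> s a \<equiv> lcat \<phi> (single s [a])"

lemma brick_label_lnil [simp]: "brick_label lnil"
  by (simp add: brick_label_def)

lemma brick_label_single [simp]: "brick_label (single s w)"
  unfolding brick_label_def by (rule finite_subset[of _ "{s}"]) (auto simp: single_def)

lemma brick_label_lcat [simp]: "brick_label (lcat \<phi> \<alpha>) \<longleftrightarrow> brick_label \<phi> \<and> brick_label \<alpha>"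
proof -
  have "{s. lcat \<phi> \<alpha> s \<noteq> []} = {s. \<phi> s \<noteq> []} \<union> {s. \<alpha> s \<noteq> []}"
    by (auto simp: lcat_def)
  then show ?thesis
    by (simp add: brick_label_def)
qed

lemma brick_label_lact [simp]:
  assumes "bij \<gamma>" and "brick_label \<alpha>"
  shows "brick_label (lact \<gamma> \<alpha>)"
proof -
  have "{s. lact \<gamma> \<alpha> s \<noteq> []} \<subseteq> \<gamma> ` {s. \<alpha> s \<noteq> []}"
  proof
    fix s assume "s \<in> {s. lact \<gamma> \<alpha> s \<noteq> []}"
    then show "s \<in> \<gamma> ` {s. \<alpha> s \<noteq> []}"
      using assms(1) by (intro image_eqI[of _ _ "finv \<gamma> s"]) (simp_all add: lact_def)
  qed
  then show ?thesis
    using assms(2) finite_surj unfolding brick_label_def by blast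
qed

lemma lcat_assoc: "lcat (lcat \<phi> \<alpha>) \<beta> = lcat \<phi> (lcat \<alpha> \<beta>)"
  by (simp add: lcat_def)

lemma lcat_lnil [simp]: "lcat \<phi> lnil = \<phi>" "lcat lnil \<phi> = \<phi>"
  by (simp_all add: lcat_def)

lemma single_Cons: "single s (a # w) = lcat (single s [a]) (single s w)"
  by (auto simp: single_def lcat_def fun_eq_iff)

lemma lact_single: "bij \<gamma> \<Longrightarrow> lact \<gamma> (single s w) = single (\<gamma> s) w"
  by (simp add: lact_def single_def fun_eq_iff finv_eq_iff)

lemma lact_lcat: "lact \<gamma> (lcat \<phi> \<alpha>) = lcat (lact \<gamma> \<phi>) (lact \<gamma> \<alpha>)"
  by (simp add: lact_def lcat_def)

lemma ext_neq: "ext \<phi> s a \<noteq> \<phi>"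
  by (auto simp: lcat_def single_def fun_eq_iff intro!: exI[of _ s])

section \<open>Canonical maps onto bricks and their composition\<close>

lemma wcat_append: "wcat (u @ v) x = wcat u (wcat v x)"
  by (auto simp: wcat_def fun_eq_iff nth_append)

lemma wcat_Nil [simp]: "wcat [] x = x"
  by (simp add: wcat_def)

lemma Phi_Phi: "Phi \<phi> (Phi \<alpha> x) = Phi (lcat \<phi> \<alpha>) x"
  by (simp add: Phi_def lcat_def wcat_append)

lemma Phi_lnil [simp]: "Phi lnil x = x"
  by (simp add: Phi_def)

lemma Phi_inv_Phi [simp]: "Phi_inv \<phi> (Phi \<phi> x) = x"
  by (simp add: Phi_def Phi_inv_def wcat_def)

lemma Phi_eq_iff [simp]: "Phi \<phi> x = Phi \<phi> y \<longleftrightarrow> x = y"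
  by (metis Phi_inv_Phi)

lemma Phi_in_brick [simp]: "Phi \<phi> x \<in> brick \<phi>"
  by (simp add: Phi_def brick_def wprefix_def wcat_def)

lemma Phi_Phi_inv [simp]: "\<kappa> \<in> brick \<phi> \<Longrightarrow> Phi \<phi> (Phi_inv \<phi> \<kappa>) = \<kappa>"
  by (auto simp: Phi_def Phi_inv_def brick_def wprefix_def wcat_def fun_eq_iff)

lemma brickE:
  assumes "\<kappa> \<in> brick \<phi>"
  obtains x where "\<kappa> = Phi \<phi> x"
  using Phi_Phi_inv[OF assms] by metis

lemma brick_lnil [simp]: "brick lnil = UNIV"
  by (simp add: brick_def wprefix_def)

lemma brick_lcat_subset: "brick (lcat \<phi> \<alpha>) \<subseteq> brick \<phi>"
  by (metis Phi_Phi Phi_in_brick brickE subsetI)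

lemma Phi_in_brick_lcat [simp]: "Phi \<phi> x \<in> brick (lcat \<phi> \<alpha>) \<longleftrightarrow> x \<in> brick \<alpha>"
  by (metis Phi_Phi Phi_eq_iff Phi_in_brick brickE)

lemma in_brick_single_iff: "x \<in> brick (single s [a]) \<longleftrightarrow> x s 0 = a"
  by (auto simp: brick_def single_def wprefix_def)

section \<open>The action of permutations on points\<close>

lemma tau_Phi: "tau \<gamma> (Phi \<alpha> x) = Phi (lact \<gamma> \<alpha>) (tau \<gamma> x)"
  by (simp add: tau_def Phi_def lact_def)

lemma tau_id [simp]: "tau id x = x"
  by (simp add: tau_def)

lemma tau_tau: "bij \<gamma> \<Longrightarrow> bij \<delta> \<Longrightarrow> tau \<gamma> (tau \<delta> x) = tau (\<gamma> \<circ> \<delta>) x"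
  by (simp add: tau_def o_inv_distrib)

lemma tau_comp: "bij \<gamma> \<Longrightarrow> bij \<delta> \<Longrightarrow> tau (\<gamma> \<circ> \<delta>) = tau \<gamma> \<circ> tau \<delta>"
  by (simp add: fun_eq_iff tau_tau)

lemma tau_inv_tau [simp]:
  assumes "bij \<gamma>"
  shows "tau \<gamma> (tau (finv \<gamma>) x) = x" "tau (finv \<gamma>) (tau \<gamma> x) = x"
  using assms by (simp_all add: tau_def)

lemma bij_tau: "bij \<gamma> \<Longrightarrow> bij (tau \<gamma>)"
  by (rule o_bij[of "tau (finv \<gamma>)"]) (simp_all add: fun_eq_iff)

lemma inv_tau: "bij \<gamma> \<Longrightarrow> finv (tau \<gamma>) = tau (finv \<gamma>)"
  by (rule inv_unique_comp) (simp_all add: fun_eq_iff)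

section \<open>Twists, local copies, swaps and baker maps\<close>

text \<open>The twist condition with the domain brick parametrised by \<open>Phi \<phi>\<close>.
  Finiteness of the labels is stated separately where it matters.\<close>

definition realizes :: "(('s \<Rightarrow> cantor) \<Rightarrow> ('s \<Rightarrow> cantor)) \<Rightarrow> ('s \<Rightarrow> bool list) \<Rightarrow> ('s \<Rightarrow> 's)
    \<Rightarrow> ('s \<Rightarrow> bool list) \<Rightarrow> bool" where
  "realizes h \<phi> \<gamma> \<psi> \<longleftrightarrow> (\<forall>x. h (Phi \<phi> x) = Phi \<psi> (tau \<gamma> x))"

text \<open>The conjugate of \<open>h\<close> by the canonical map onto a brick, extended by the
  identity. For a fixed brick it respects composition.\<close>

definition loc :: "('s \<Rightarrow> bool list) \<Rightarrow> (('s \<Rightarrow> cantor) \<Rightarrow> ('s \<Rightarrow> cantor))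
    \<Rightarrow> ('s \<Rightarrow> cantor) \<Rightarrow> ('s \<Rightarrow> cantor)" where
  "loc \<phi> h \<kappa> = (if \<kappa> \<in> brick \<phi> then Phi \<phi> (h (Phi_inv \<phi> \<kappa>)) else \<kappa>)"

definition sw :: "('s \<Rightarrow> bool list) \<Rightarrow> ('s \<Rightarrow> bool list) \<Rightarrow> ('s \<Rightarrow> cantor) \<Rightarrow> ('s \<Rightarrow> cantor)" where
  "sw \<phi> \<psi> \<kappa> = (if \<kappa> \<in> brick \<phi> then Phi \<psi> (Phi_inv \<phi> \<kappa>)
     else if \<kappa> \<in> brick \<psi> then Phi \<phi> (Phi_inv \<psi> \<kappa>) else \<kappa>)"

text \<open>The baker map takes the first bit off coordinate \<open>s\<close> and puts it in front
  of coordinate \<open>t\<close>. It carries the halving in direction \<open>s\<close> to the one in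
  direction \<open>t\<close> without permuting coordinates; for \<open>s = t\<close> it is the
  identity.\<close>

definition bk :: "'s \<Rightarrow> 's \<Rightarrow> ('s \<Rightarrow> cantor) \<Rightarrow> ('s \<Rightarrow> cantor)" where
  "bk s t \<kappa> = Phi (single t [\<kappa> s 0]) (Phi_inv (single s [\<kappa> s 0]) \<kappa>)"

definition apart :: "('s \<Rightarrow> bool list) \<Rightarrow> ('s \<Rightarrow> bool list) \<Rightarrow> bool" where
  "apart \<phi> \<psi> \<longleftrightarrow> brick \<phi> \<inter> brick \<psi> = {}"

section \<open>Calculus of twists between bricks\<close>

lemma realizesD: "realizes h \<phi> \<gamma> \<psi> \<Longrightarrow> h (Phi \<phi> x) = Phi \<psi> (tau \<gamma> x)"
  by (simp add: realizes_def)

lemma realizes_twist: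
  "(\<forall>\<kappa>\<in>brick \<phi>. h \<kappa> = twist \<phi> \<psi> \<gamma> \<kappa>) \<longleftrightarrow> realizes h \<phi> \<gamma> \<psi>"
  unfolding realizes_def twist_def
  by (metis Phi_in_brick Phi_inv_Phi brickE comp_apply)

lemma realizes_comp:
  assumes "realizes h \<phi> \<gamma> \<psi>" "realizes k \<psi> \<delta> \<rho>" "bij \<gamma>" "bij \<delta>"
  shows "realizes (k \<circ> h) \<phi> (\<delta> \<circ> \<gamma>) \<rho>"
  using assms by (simp add: realizes_def tau_tau)

lemma realizes_inv:
  assumes "realizes h \<phi> \<gamma> \<psi>" "bij h" "bij \<gamma>"
  shows "realizes (finv h) \<psi> (finv \<gamma>) \<phi>"
  unfolding realizes_def
proof
  fix x
  have "h (Phi \<phi> (tau (finv \<gamma>) x)) = Phi \<psi> x"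
    using realizesD[OF assms(1)] assms(3) by simp
  then show "finv h (Phi \<psi> x) = Phi \<phi> (tau (finv \<gamma>) x)"
    using assms(2) by (metis bij_finv(1))
qed

text \<open>A twist restricts to smaller bricks with the same permutation, but the added letters are
  permuted along with the coordinates that carry them.\<close>

lemma realizes_lcat:
  "realizes h \<phi> \<gamma> \<psi> \<Longrightarrow> realizes h (lcat \<phi> \<alpha>) \<gamma> (lcat \<psi> (lact \<gamma> \<alpha>))"
  by (simp add: realizes_def tau_Phi flip: Phi_Phi)

lemma lact_id [simp]: "lact id \<alpha> = \<alpha>"
  by (simp add: lact_def)

lemma realizes_ext:
  assumes "realizes h \<phi> \<gamma> \<psi>" "bij \<gamma>"
  shows "realizes h (ext \<phi> s a) \<gamma> (ext \<psi> (\<gamma> s) a)"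
  using realizes_lcat[OF assms(1), of "single s [a]"] assms(2) by (simp add: lact_single)

lemma realizes_image:
  assumes "realizes h \<phi> \<gamma> \<psi>" "bij \<gamma>"
  shows "h ` brick \<phi> = brick \<psi>"
proof
  show "h ` brick \<phi> \<subseteq> brick \<psi>"
    using assms(1) by (auto simp: realizes_def elim!: brickE)
  show "brick \<psi> \<subseteq> h ` brick \<phi>"
  proof
    fix \<kappa> assume "\<kappa> \<in> brick \<psi>"
    then obtain x where "\<kappa> = Phi \<psi> x" by (rule brickE)
    then have "\<kappa> = h (Phi \<phi> (tau (finv \<gamma>) x))"
      using assms by (simp add: realizesD)
    then show "\<kappa> \<in> h ` brick \<phi>" by simp
  qed
qed

lemma realizes_in_brick_iff:
  assumes "realizes h \<phi> \<gamma> \<psi>" "bij \<gamma>" "bij h"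
  shows "h \<kappa> \<in> brick \<psi> \<longleftrightarrow> \<kappa> \<in> brick \<phi>"
  using realizes_image[OF assms(1,2)] assms(3) by (metis bij_is_inj inj_image_mem_iff)

lemma realizes_fix:
  "(\<And>\<kappa>. \<kappa> \<in> brick \<phi> \<Longrightarrow> h \<kappa> = \<kappa>) \<Longrightarrow> realizes h \<phi> id \<phi>"
  by (simp add: realizes_def)

lemma realizes_id: "realizes id \<phi> id \<phi>"
  by (simp add: realizes_def)

lemma realizes_tau: "realizes (tau \<gamma>) \<alpha> \<gamma> (lact \<gamma> \<alpha>)"
  by (simp add: realizes_def tau_Phi)

lemma apart_sym: "apart \<phi> \<psi> \<Longrightarrow> apart \<psi> \<phi>"
  by (auto simp: apart_def)

lemma apart_lcat: "apart \<phi> \<psi> \<Longrightarrow> apart (lcat \<phi> \<alpha>) (lcat \<psi> \<beta>)"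
  using brick_lcat_subset unfolding apart_def by fast

lemma apart_lcat_left: "apart \<phi> \<psi> \<Longrightarrow> apart (lcat \<phi> \<alpha>) \<psi>"
  using apart_lcat[of \<phi> \<psi> \<alpha> lnil] by simp

lemma apart_single: "apart (single s [a]) (single s [\<not> a])"
  by (auto simp: apart_def in_brick_single_iff)

lemma apart_Phi: "apart \<phi> \<psi> \<Longrightarrow> Phi \<phi> x \<notin> brick \<psi>"
  unfolding apart_def by (metis Phi_in_brick disjoint_iff)

lemma apart_realizes:
  assumes "apart \<phi> \<phi>'" "realizes h \<phi> \<gamma> \<psi>" "realizes h \<phi>' \<gamma>' \<psi>'" "bij h" "bij \<gamma>" "bij \<gamma>'"
  shows "apart \<psi> \<psi>'"
proof -
  have "brick \<psi> \<inter> brick \<psi>' = h ` (brick \<phi> \<inter> brick \<phi>')"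
    using assms by (simp add: image_Int bij_is_inj realizes_image)
  then show ?thesis using assms(1) by (simp add: apart_def)
qed

section \<open>Copies of a map inside a brick\<close>

lemma loc_Phi [simp]: "loc \<phi> h (Phi \<phi> x) = Phi \<phi> (h x)"
  by (simp add: loc_def)

lemma loc_outside: "\<kappa> \<notin> brick \<phi> \<Longrightarrow> loc \<phi> h \<kappa> = \<kappa>"
  by (simp add: loc_def)

lemma loc_comp: "loc \<phi> (h \<circ> k) = loc \<phi> h \<circ> loc \<phi> k"
proof
  show "loc \<phi> (h \<circ> k) \<kappa> = (loc \<phi> h \<circ> loc \<phi> k) \<kappa>" for \<kappa>
    by (cases "\<kappa> \<in> brick \<phi>") (auto simp: loc_outside elim!: brickE)
qed

lemma loc_id [simp]: "loc \<phi> id = id"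
  by (auto simp: loc_def fun_eq_iff)

lemma loc_lnil [simp]: "loc lnil h = h"
  by (simp add: loc_def fun_eq_iff Phi_inv_def)

lemma bij_finv_comp: "bij h \<Longrightarrow> h \<circ> finv h = id" "bij h \<Longrightarrow> finv h \<circ> h = id"
  by (simp_all add: fun_eq_iff)

lemma bij_loc: "bij h \<Longrightarrow> bij (loc \<phi> h)"
  by (rule o_bij[of "loc \<phi> (finv h)"]) (simp_all add: bij_finv_comp flip: loc_comp)

lemma finv_loc: "bij h \<Longrightarrow> finv (loc \<phi> h) = loc \<phi> (finv h)"
  by (rule inv_unique_comp) (simp_all add: bij_finv_comp flip: loc_comp)

lemma realizes_loc: "realizes h \<alpha> \<gamma> \<beta> \<Longrightarrow> realizes (loc \<phi> h) (lcat \<phi> \<alpha>) \<gamma> (lcat \<phi> \<beta>)"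
  by (simp add: realizes_def flip: Phi_Phi)

lemma realizes_loc_apart: "apart \<phi> \<psi> \<Longrightarrow> realizes (loc \<phi> h) \<psi> id \<psi>"
  by (rule realizes_fix) (auto simp: loc_def apart_def)

lemma realizes_loc_tau: "realizes (loc \<phi> (tau \<gamma>)) \<phi> \<gamma> \<phi>"
  by (simp add: realizes_def)

section \<open>Baker maps\<close>

lemma realizes_bk: "realizes (bk s t) (single s [a]) id (single t [a])"
proof -
  have "Phi (single s [a]) x s 0 = a" for x
    using in_brick_single_iff[of "Phi (single s [a]) x" s a] by simp
  then show ?thesis by (simp add: realizes_def bk_def)
qed

lemma bk_bk [simp]: "bk t s (bk s t \<kappa>) = \<kappa>"
proof -
  have "\<kappa> \<in> brick (single s [\<kappa> s 0])" by (simp add: in_brick_single_iff)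
  then obtain x where x: "\<kappa> = Phi (single s [\<kappa> s 0]) x" by (rule brickE)
  show ?thesis
    by (subst (1 2) x) (simp add: realizesD[OF realizes_bk])
qed

lemma bij_bk: "bij (bk s t)"
  by (rule o_bij[of "bk t s"]) (simp_all add: fun_eq_iff)

section \<open>Swaps of disjoint bricks\<close>

lemma realizes_sw1: "realizes (sw \<phi> \<psi>) \<phi> id \<psi>"
  by (simp add: realizes_def sw_def)

lemma realizes_sw2: "apart \<phi> \<psi> \<Longrightarrow> realizes (sw \<phi> \<psi>) \<psi> id \<phi>"
  by (simp add: realizes_def sw_def apart_Phi apart_sym)

lemma realizes_sw_apart: "apart \<phi> \<rho> \<Longrightarrow> apart \<psi> \<rho> \<Longrightarrow> realizes (sw \<phi> \<psi>) \<rho> id \<rho>"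
  by (rule realizes_fix) (auto simp: sw_def apart_def)

lemma sw_outside: "\<kappa> \<notin> brick \<phi> \<Longrightarrow> \<kappa> \<notin> brick \<psi> \<Longrightarrow> sw \<phi> \<psi> \<kappa> = \<kappa>"
  by (simp add: sw_def)

lemma sw_Phi:
  "sw \<phi> \<psi> (Phi \<phi> x) = Phi \<psi> x"
  "apart \<phi> \<psi> \<Longrightarrow> sw \<phi> \<psi> (Phi \<psi> x) = Phi \<phi> x"
  using realizesD[OF realizes_sw1, of \<phi> \<psi> x] realizesD[OF realizes_sw2, of \<phi> \<psi> x] by simp_all

lemma sw_sw:
  assumes "apart \<phi> \<psi>"
  shows "sw \<phi> \<psi> (sw \<phi> \<psi> \<kappa>) = \<kappa>"
proof -
  consider "\<kappa> \<in> brick \<phi>" | "\<kappa> \<in> brick \<psi>" | "\<kappa> \<notin> brick \<phi>" "\<kappa> \<notin> brick \<psi>" by blast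
  then show ?thesis
    using assms by cases (auto simp: sw_Phi sw_outside elim!: brickE)
qed

lemma bij_sw: "apart \<phi> \<psi> \<Longrightarrow> bij (sw \<phi> \<psi>)"
  by (rule o_bij[of "sw \<phi> \<psi>"]) (simp_all add: fun_eq_iff sw_sw)

text \<open>On the two bricks \<open>g\<close> acts canonically, and off them both sides are the
  identity. This conjugates swaps of small pieces to a single generator.\<close>

lemma sw_conj:
  assumes g: "bij g" "realizes g \<phi> id \<phi>'" "realizes g \<psi> id \<psi>'"
    and d: "apart \<phi> \<psi>"
  shows "sw \<phi> \<psi> = finv g \<circ> sw \<phi>' \<psi>' \<circ> g"
proof -
  have d': "apart \<phi>' \<psi>'" using apart_realizes[OF d g(2,3,1)] by simp
  have "g (sw \<phi> \<psi> \<kappa>) = sw \<phi>' \<psi>' (g \<kappa>)" for \<kappa>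
  proof -
    consider x where "\<kappa> = Phi \<phi> x" | x where "\<kappa> = Phi \<psi> x" | "\<kappa> \<notin> brick \<phi>" "\<kappa> \<notin> brick \<psi>"
      by (metis brickE)
    then show ?thesis
    proof cases
      case 3
      then have "g \<kappa> \<notin> brick \<phi>'" "g \<kappa> \<notin> brick \<psi>'"
        using realizes_in_brick_iff[OF g(2) bij_id g(1)] realizes_in_brick_iff[OF g(3) bij_id g(1)]
        by auto
      with 3 show ?thesis by (simp add: sw_outside)
    qed (use d d' in \<open>simp_all add: sw_Phi realizesD[OF g(2)] realizesD[OF g(3)]\<close>)
  qed
  then have "finv g (sw \<phi>' \<psi>' (g \<kappa>)) = sw \<phi> \<psi> \<kappa>" for \<kappa>
    using g(1) by (metis bij_finv(1))
  then show ?thesis by (simp add: fun_eq_iff)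
qed

text \<open>Conjugation only sees how \<open>g\<close> acts on the supporting brick, so one copy of
  \<open>h\<close> yields copies on all bricks reached canonically from \<phi>.\<close>

lemma loc_conj:
  assumes g: "bij g" "realizes g \<phi> id \<psi>"
  shows "loc \<psi> h = g \<circ> loc \<phi> h \<circ> finv g"
proof -
  have "loc \<psi> h (g \<kappa>) = g (loc \<phi> h \<kappa>)" for \<kappa>
  proof (cases "\<kappa> \<in> brick \<phi>")
    case True
    then show ?thesis by (auto simp: realizesD[OF g(2)] elim!: brickE)
  next
    case False
    then have "g \<kappa> \<notin> brick \<psi>"
      using realizes_in_brick_iff[OF g(2) bij_id g(1)] by simp
    with False show ?thesis by (simp add: loc_outside)
  qed
  then have "g (loc \<phi> h (finv g \<kappa>)) = loc \<psi> h \<kappa>" for \<kappa>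
    using g(1) by (metis bij_finv(2))
  then show ?thesis by (simp add: fun_eq_iff)
qed

section \<open>The local description of twisted Brin--Thompson groups\<close>

text \<open>A pointwise form of the condition defining \<open>SV G\<close>, free of partitions, so
  that compositions can be treated near one point. Compactness recovers the partitions in
  \<open>SV_iff\<close>.\<close>

definition locally_twist :: "('s \<Rightarrow> 's) set \<Rightarrow> (('s \<Rightarrow> cantor) \<Rightarrow> ('s \<Rightarrow> cantor)) \<Rightarrow> bool" where
  "locally_twist G h \<longleftrightarrow> (\<forall>\<kappa>. \<exists>\<phi> \<psi> \<gamma>. brick_label \<phi> \<and> brick_label \<psi> \<and> \<gamma> \<in> G \<and>
     \<kappa> \<in> brick \<phi> \<and> realizes h \<phi> \<gamma> \<psi>)"

text \<open>The label of the cell containing \<kappa> in the grid of depth \<open>L s\<close> at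
  each coordinate \<open>s\<close>.\<close>

definition pre :: "('s \<Rightarrow> cantor) \<Rightarrow> ('s \<Rightarrow> nat) \<Rightarrow> 's \<Rightarrow> bool list" where
  "pre \<kappa> L = (\<lambda>s. map (\<kappa> s) [0..<L s])"

definition labels_of :: "('s \<Rightarrow> nat) \<Rightarrow> ('s \<Rightarrow> bool list) set" where
  "labels_of L = {\<phi>. \<forall>s. length (\<phi> s) = L s}"

lemma locally_twistE:
  assumes "locally_twist G h"
  obtains \<phi> \<psi> \<gamma> x where "brick_label \<phi>" "brick_label \<psi>" "\<gamma> \<in> G" "\<kappa> = Phi \<phi> x" "realizes h \<phi> \<gamma> \<psi>"
  using assms unfolding locally_twist_def by (metis brickE)

lemma locally_twistI:
  assumes "\<And>\<kappa>. \<exists>\<phi> \<psi> \<gamma>. brick_label \<phi> \<and> brick_label \<psi> \<and> \<gamma> \<in> G \<and>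
     \<kappa> \<in> brick \<phi> \<and> realizes h \<phi> \<gamma> \<psi>"
  shows "locally_twist G h"
  using assms by (simp add: locally_twist_def)

lemma in_brick_pre: "x \<in> brick (pre \<kappa> L) \<longleftrightarrow> (\<forall>s. \<forall>i<L s. x s i = \<kappa> s i)"
  by (auto simp: brick_def wprefix_def pre_def)

lemma pre_in_brick [simp]: "\<kappa> \<in> brick (pre \<kappa> L)"
  by (simp add: in_brick_pre)

lemma brick_label_pre: "finite {s. L s \<noteq> 0} \<Longrightarrow> brick_label (pre \<kappa> L)"
  by (simp add: brick_label_def pre_def)

lemma pre_labels_of [simp]: "pre \<kappa> L \<in> labels_of L"
  by (simp add: labels_of_def pre_def)

lemma brick_iff_nth: "\<kappa> \<in> brick \<phi> \<longleftrightarrow> (\<forall>s. \<forall>i<length (\<phi> s). \<kappa> s i = \<phi> s ! i)"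
  by (simp add: brick_def wprefix_def)

text \<open>A point determines its cell in a grid of fixed depths; hence distinct cells are
  disjoint.\<close>

lemma labels_of_eq_pre: "\<phi> \<in> labels_of L \<Longrightarrow> \<kappa> \<in> brick \<phi> \<Longrightarrow> \<phi> = pre \<kappa> L"
  by (auto simp: labels_of_def pre_def brick_iff_nth fun_eq_iff intro!: nth_equalityI)

text \<open>Reading a point of a brick at least to the depth of the label only appends letters. This
  yields common refinements of bricks through one point.\<close>

lemma pre_eq_lcat:
  assumes "\<kappa> \<in> brick \<phi>" and "\<And>s. length (\<phi> s) \<le> L s"
  obtains \<beta> where "pre \<kappa> L = lcat \<phi> \<beta>"
proof
  show "pre \<kappa> L = lcat \<phi> (\<lambda>s. drop (length (\<phi> s)) (pre \<kappa> L s))"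
  proof
    fix s
    have "take (length (\<phi> s)) (pre \<kappa> L s) = \<phi> s"
      using assms by (auto simp: pre_def brick_iff_nth take_map intro!: nth_equalityI)
    then show "pre \<kappa> L s = lcat \<phi> (\<lambda>s. drop (length (\<phi> s)) (pre \<kappa> L s)) s"
      by (metis append_take_drop_id lcat_def)
  qed
qed

lemma brick_label_length: "brick_label \<phi> \<longleftrightarrow> finite {s. length (\<phi> s) \<noteq> 0}"
  by (simp add: brick_label_def)

lemma brick_label_pre_length: "brick_label \<phi> \<Longrightarrow> brick_label (pre \<kappa> (\<lambda>s. length (\<phi> s)))"
  by (rule brick_label_pre) (simp add: brick_label_length)

lemma apart_neighbourhood:
  assumes "brick_label \<phi>" "brick_label \<psi>" "\<kappa> \<notin> brick \<phi>" "\<kappa> \<notin> brick \<psi>"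
  obtains \<rho> where "brick_label \<rho>" "\<kappa> \<in> brick \<rho>" "apart \<phi> \<rho>" "apart \<psi> \<rho>"
proof
  \<comment> \<open>All bits inspected by \<phi> or \<psi> are recorded, so a point of this cell
    lying in either brick would force \<kappa> into that brick.\<close>
  let ?\<rho> = "pre \<kappa> (\<lambda>s. length (lcat \<phi> \<psi> s))"
  show "brick_label ?\<rho>"
    using assms by (intro brick_label_pre_length) simp
  show "\<kappa> \<in> brick ?\<rho>" by simp
  have "\<kappa> \<in> brick \<alpha>"
    if "x \<in> brick ?\<rho>" "x \<in> brick \<alpha>" "\<And>s. length (\<alpha> s) \<le> length (lcat \<phi> \<psi> s)" for x \<alpha>
    unfolding brick_iff_nth
  proof (intro allI impI)
    fix s i assume i: "i < length (\<alpha> s)"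
    with that(3)[of s] have "x s i = \<kappa> s i" using that(1) by (simp add: in_brick_pre)
    then show "\<kappa> s i = \<alpha> s ! i" using that(2) i by (simp add: brick_iff_nth)
  qed
  then show "apart \<phi> ?\<rho>" "apart \<psi> ?\<rho>"
    using assms(3,4) by (auto simp: apart_def lcat_def)
qed

section \<open>Closure properties of local twists\<close>

lemma locally_twist_comp:
  assumes "perm_group G" "locally_twist G h" "locally_twist G k"
  shows "locally_twist G (k \<circ> h)"
proof (rule locally_twistI)
  fix \<kappa>
  obtain \<phi> \<psi> \<gamma> x where 1: "brick_label \<phi>" "brick_label \<psi>" "\<gamma> \<in> G" "\<kappa> = Phi \<phi> x" "realizes h \<phi> \<gamma> \<psi>"
    using assms(2) by (rule locally_twistE)
  obtain \<phi>' \<psi>' \<delta> x' where 2: "brick_label \<phi>'" "brick_label \<psi>'" "\<delta> \<in> G" "h \<kappa> = Phi \<phi>' x'"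
    "realizes k \<phi>' \<delta> \<psi>'"
    using assms(3) by (rule locally_twistE)
  have b: "bij \<gamma>" "bij \<delta>" using 1 2 assms(1) by (auto simp: perm_group_def)
  have hk: "h \<kappa> = Phi \<psi> (tau \<gamma> x)" using 1 by (simp add: realizesD)
  \<comment> \<open>The lengths of both labels are added, so the cell of \<open>h \<kappa>\<close>
    to this depth refines the range of the first twist and the domain of the second.\<close>
  let ?L = "\<lambda>s. length (lcat \<psi> \<phi>' s)"
  let ?\<rho> = "pre (h \<kappa>) ?L"
  obtain \<beta> where \<beta>: "?\<rho> = lcat \<psi> \<beta>"
    by (rule pre_eq_lcat[of "h \<kappa>" \<psi> ?L]) (simp_all add: hk lcat_def)
  obtain \<beta>' where \<beta>': "?\<rho> = lcat \<phi>' \<beta>'"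
    by (rule pre_eq_lcat[of "h \<kappa>" \<phi>' ?L]) (simp_all add: 2 lcat_def)
  have "brick_label ?\<rho>"
    using 1 2 by (intro brick_label_pre_length) simp
  then have lab: "brick_label \<beta>" "brick_label \<beta>'" using \<beta> \<beta>' brick_label_lcat by metis+
  \<comment> \<open>The refinement of the range is pulled back through \<gamma> to one of the
    domain.\<close>
  let ?\<alpha> = "lact (finv \<gamma>) \<beta>"
  have \<alpha>: "lact \<gamma> ?\<alpha> = \<beta>" using b by (simp add: lact_def)
  have "realizes h (lcat \<phi> ?\<alpha>) \<gamma> (lcat \<phi>' \<beta>')"
    using realizes_lcat[OF 1(5), of ?\<alpha>] \<alpha> \<beta> \<beta>' by simp
  then have "realizes (k \<circ> h) (lcat \<phi> ?\<alpha>) (\<delta> \<circ> \<gamma>) (lcat \<psi>' (lact \<delta> \<beta>'))"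
    using realizes_comp realizes_lcat[OF 2(5)] b by blast
  moreover have "\<kappa> \<in> brick (lcat \<phi> ?\<alpha>)"
  proof -
    have "tau \<gamma> x \<in> brick \<beta>"
      using pre_in_brick[of "h \<kappa>" ?L] unfolding \<beta> by (simp add: hk)
    then have "x \<in> brick ?\<alpha>"
      by (metis Phi_in_brick b(1) brickE tau_Phi tau_inv_tau(2))
    then show ?thesis by (simp add: 1)
  qed
  moreover have "\<delta> \<circ> \<gamma> \<in> G" using assms(1) 1 2 by (simp add: perm_group_comp)
  ultimately show "\<exists>\<phi> \<psi> \<gamma>. brick_label \<phi> \<and> brick_label \<psi> \<and> \<gamma> \<in> G \<and>
     \<kappa> \<in> brick \<phi> \<and> realizes (k \<circ> h) \<phi> \<gamma> \<psi>"
    using 1 2 b lab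
    by (intro exI[of _ "lcat \<phi> ?\<alpha>"] exI[of _ "lcat \<psi>' (lact \<delta> \<beta>')"] exI[of _ "\<delta> \<circ> \<gamma>"]) simp
qed

lemma locally_twist_inv:
  assumes "perm_group G" "locally_twist G h" "bij h"
  shows "locally_twist G (finv h)"
proof (rule locally_twistI)
  fix \<kappa>
  obtain \<phi> \<psi> \<gamma> x where 1: "brick_label \<phi>" "brick_label \<psi>" "\<gamma> \<in> G" "finv h \<kappa> = Phi \<phi> x"
    "realizes h \<phi> \<gamma> \<psi>"
    using assms(2) by (rule locally_twistE)
  have "\<kappa> = Phi \<psi> (tau \<gamma> x)" using 1 assms(3) by (metis bij_finv(2) realizesD)
  then show "\<exists>\<phi> \<psi> \<gamma>. brick_label \<phi> \<and> brick_label \<psi> \<and> \<gamma> \<in> G \<and>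
     \<kappa> \<in> brick \<phi> \<and> realizes (finv h) \<phi> \<gamma> \<psi>"
    using realizes_inv[OF 1(5) assms(3)] 1 assms(1) perm_group_bij[OF assms(1)]
      perm_group_inv[OF assms(1)]
    by (intro exI[of _ \<psi>] exI[of _ \<phi>] exI[of _ "finv \<gamma>"]) simp
qed

lemma locally_twist_tau:
  assumes "\<gamma> \<in> G"
  shows "locally_twist G (tau \<gamma>)"
  by (rule locally_twistI) (rule exI[of _ lnil], rule exI[of _ lnil], rule exI[of _ \<gamma>],
    simp add: assms realizes_def)

lemma perm_group_locally_twist:
  assumes "perm_group G"
  shows "perm_group {h. bij h \<and> locally_twist G h}"
proof -
  have "tau id = id" by (simp add: fun_eq_iff)
  then have "locally_twist G id"
    using locally_twist_tau[OF perm_group_id[OF assms]] by metis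
  then show ?thesis
    using
      locally_twist_comp[OF assms] locally_twist_inv[OF assms]
    by (auto simp: perm_group_def bij_comp)
qed

text \<open>A point outside the brick has a whole brick around it outside, where the copy is the
  identity: bricks with finite labels are closed.\<close>

lemma locally_twist_loc:
  assumes "perm_group G" "locally_twist G h" "brick_label \<phi>"
  shows "locally_twist G (loc \<phi> h)"
proof (rule locally_twistI)
  fix \<kappa>
  show "\<exists>\<phi>' \<psi> \<gamma>. brick_label \<phi>' \<and> brick_label \<psi> \<and> \<gamma> \<in> G \<and>
     \<kappa> \<in> brick \<phi>' \<and> realizes (loc \<phi> h) \<phi>' \<gamma> \<psi>"
  proof (cases "\<kappa> \<in> brick \<phi>")
    case True
    then obtain x where x: "\<kappa> = Phi \<phi> x" by (rule brickE)
    obtain \<alpha> \<beta> \<gamma> y where "brick_label \<alpha>" "brick_label \<beta>" "\<gamma> \<in> G" "x = Phi \<alpha> y" "realizes h \<alpha> \<gamma> \<beta>"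
      using assms(2) by (rule locally_twistE)
    then show ?thesis
      using x assms(3) realizes_loc
      by (intro exI[of _ "lcat \<phi> \<alpha>"] exI[of _ "lcat \<phi> \<beta>"] exI[of _ \<gamma>]) simp
  next
    case False
    with assms(3) obtain \<rho> where "brick_label \<rho>" "\<kappa> \<in> brick \<rho>" "apart \<phi> \<rho>"
      using apart_neighbourhood by metis
    then show ?thesis
      using perm_group_id[OF assms(1)] realizes_loc_apart by blast
  qed
qed

lemma locally_twist_sw:
  assumes "perm_group G" "brick_label \<phi>" "brick_label \<psi>" "apart \<phi> \<psi>"
  shows "locally_twist G (sw \<phi> \<psi>)"
proof (rule locally_twistI)
  fix \<kappa>
  consider "\<kappa> \<in> brick \<phi>" | "\<kappa> \<in> brick \<psi>" | "\<kappa> \<notin> brick \<phi>" "\<kappa> \<notin> brick \<psi>" by blast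
  then show "\<exists>\<phi>' \<psi>' \<gamma>. brick_label \<phi>' \<and> brick_label \<psi>' \<and> \<gamma> \<in> G \<and>
     \<kappa> \<in> brick \<phi>' \<and> realizes (sw \<phi> \<psi>) \<phi>' \<gamma> \<psi>'"
  proof cases
    case 3
    then obtain \<rho> where "brick_label \<rho>" "\<kappa> \<in> brick \<rho>" "apart \<phi> \<rho>" "apart \<psi> \<rho>"
      using assms(2,3) apart_neighbourhood by metis
    then show ?thesis
      using perm_group_id[OF assms(1)] realizes_sw_apart by blast
  qed (use assms perm_group_id[OF assms(1)] realizes_sw1 realizes_sw2 in blast)+
qed

lemma locally_twist_bk: "id \<in> G \<Longrightarrow> locally_twist G (bk s t)"
  using realizes_bk[of s t]
  by (intro locally_twistI) (metis brick_label_single in_brick_single_iff)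

section \<open>Continuity, compactness and the equivalence of the two descriptions\<close>

lemma openin_coordinate: "openin cantorS_top {\<kappa>. \<kappa> s i = b}"
proof -
  have "continuous_map cantorS_top cantor_top (\<lambda>\<kappa>. \<kappa> s)"
    unfolding cantorS_top_def by (rule continuous_map_product_projection) simp
  moreover have "continuous_map cantor_top (discrete_topology UNIV) (\<lambda>x. x i)"
    unfolding cantor_top_def by (rule continuous_map_product_projection) simp
  ultimately have "continuous_map cantorS_top (discrete_topology UNIV) ((\<lambda>x. x i) \<circ> (\<lambda>\<kappa>. \<kappa> s))"
    by (rule continuous_map_compose)
  from openin_continuous_map_preimage[OF this, of "{b}"] show ?thesis
    by (simp add: cantorS_top_def cantor_top_def)
qed

lemma topspace_cantorS [simp]: "topspace cantorS_top = UNIV"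
  by (simp add: cantorS_top_def cantor_top_def)

lemma openin_brick:
  assumes "brick_label \<phi>"
  shows "openin cantorS_top (brick \<phi>)"
proof -
  let ?I = "SIGMA s:{s. \<phi> s \<noteq> []}. {..<length (\<phi> s)}"
  have "\<kappa> \<in> brick \<phi> \<longleftrightarrow> (\<forall>p\<in>?I. \<kappa> (fst p) (snd p) = \<phi> (fst p) ! snd p)" for \<kappa>
    unfolding brick_iff_nth by (simp add: Ball_def) (metis list.size(3) not_less_zero)
  then have "brick \<phi> = UNIV \<inter> (\<Inter>p\<in>?I. {\<kappa>. \<kappa> (fst p) (snd p) = \<phi> (fst p) ! snd p})"
    by blast
  moreover have "openin cantorS_top (UNIV \<inter> (\<Inter>p\<in>?I. {\<kappa>. \<kappa> (fst p) (snd p) = \<phi> (fst p) ! snd p}))"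
    using assms openin_topspace[of cantorS_top]
    by (intro openin_Int_Inter) (auto simp: brick_label_def openin_coordinate)
  ultimately show ?thesis by simp
qed

text \<open>On a brick where \<open>h\<close> is a twist, each output bit is either a fixed letter
  of the range label or one fixed input bit.\<close>

lemma continuous_locally_twist:
  assumes "locally_twist G h"
  shows "continuous_map cantorS_top cantorS_top h"
proof -
  have "openin cantorS_top {\<kappa>. h \<kappa> s i \<in> U}" for s i U
  proof (subst openin_subopen, safe)
    fix \<kappa> assume U: "h \<kappa> s i \<in> U"
    obtain \<phi> \<psi> \<gamma> x where 1: "brick_label \<phi>" "\<kappa> = Phi \<phi> x" "realizes h \<phi> \<gamma> \<psi>"
      using assms by (rule locally_twistE)
    let ?t = "finv \<gamma> s"
    let ?j = "i - length (\<psi> s) + length (\<phi> ?t)"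
    have h: "h y s i = (if i < length (\<psi> s) then \<psi> s ! i else y ?t ?j)" if "y \<in> brick \<phi>" for y
    proof -
      have "y = Phi \<phi> (Phi_inv \<phi> y)" using that by simp
      then have "h y = Phi \<psi> (tau \<gamma> (Phi_inv \<phi> y))" using realizesD[OF 1(3)] by metis
      then show ?thesis by (simp add: Phi_def Phi_inv_def tau_def wcat_def)
    qed
    let ?T = "brick \<phi> \<inter> {y. y ?t ?j = \<kappa> ?t ?j}"
    have "openin cantorS_top ?T"
      using 1 by (intro openin_Int openin_brick openin_coordinate)
    moreover have "\<kappa> \<in> ?T" "?T \<subseteq> {\<kappa>. h \<kappa> s i \<in> U}"
      using U h 1(2) by auto
    ultimately show "\<exists>T. openin cantorS_top T \<and> \<kappa> \<in> T \<and> T \<subseteq> {\<kappa>. h \<kappa> s i \<in> U}" by blast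
  qed
  then have "continuous_map cantorS_top (discrete_topology UNIV) (\<lambda>\<kappa>. h \<kappa> s i)" for s i
    by (simp add: continuous_map_def)
  then show ?thesis
    by (subst (2) cantorS_top_def)
      (simp add: cantor_top_def continuous_map_componentwise_UNIV)
qed

lemma finite_labels_of:
  assumes "finite {s. L s \<noteq> 0}"
  shows "finite (labels_of L)"
proof -
  let ?T = "{s. L s \<noteq> 0}"
  let ?B = "{w :: bool list. set w \<subseteq> UNIV \<and> length w \<le> Max (L ` ?T)}"
  have "labels_of L \<subseteq> {f. \<forall>s. (s \<in> ?T \<longrightarrow> f s \<in> ?B) \<and> (s \<notin> ?T \<longrightarrow> f s = [])}"
  proof
    fix \<phi> assume "\<phi> \<in> labels_of L"
    then have "length (\<phi> s) = L s" for s by (simp add: labels_of_def)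
    then show "\<phi> \<in> {f. \<forall>s. (s \<in> ?T \<longrightarrow> f s \<in> ?B) \<and> (s \<notin> ?T \<longrightarrow> f s = [])}"
      using assms by (auto simp flip: length_0_conv)
  qed
  moreover have "finite {f. \<forall>s. (s \<in> ?T \<longrightarrow> f s \<in> ?B) \<and> (s \<notin> ?T \<longrightarrow> f s = [])}"
    by (rule finite_set_of_finite_funs[OF assms finite_lists_length_le]) simp
  ultimately show ?thesis by (rule finite_subset)
qed

lemma compact_cantorS: "compact_space cantorS_top"
  by (simp add: cantorS_top_def cantor_top_def compact_space_product_topology
      compact_space_discrete_topology)

text \<open>By compactness finitely many of the bricks in the definition of \<^const>\<open>locally_twist\<close>
  suffice, and all labels of sufficiently large uniform lengths refine these.\<close>
lemma locally_twist_uniform: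
  assumes h: "locally_twist G h" and G: "perm_group G"
  obtains L where "finite {s. L s \<noteq> 0}"
    "\<And>\<rho>. \<rho> \<in> labels_of L \<Longrightarrow> \<exists>\<psi> \<gamma>. brick_label \<psi> \<and> \<gamma> \<in> G \<and> realizes h \<rho> \<gamma> \<psi>"
proof -
  define C where "C = {\<phi>. brick_label \<phi> \<and> (\<exists>\<psi> \<gamma>. brick_label \<psi> \<and> \<gamma> \<in> G \<and> realizes h \<phi> \<gamma> \<psi>)}"
  have "\<forall>\<kappa>. \<exists>\<phi>\<in>C. \<kappa> \<in> brick \<phi>"
    using h unfolding locally_twist_def C_def by blast
  then have "topspace cantorS_top \<subseteq> \<Union>(brick ` C)" by auto
  moreover have "\<forall>U\<in>brick ` C. openin cantorS_top U"
    using openin_brick by (auto simp: C_def)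
  ultimately obtain F where F: "finite F" "F \<subseteq> brick ` C" "UNIV \<subseteq> \<Union>F"
    using compact_cantorS[unfolded compact_space_alt, rule_format, of "brick ` C"]
    by (metis topspace_cantorS)
  then obtain D where D: "D \<subseteq> C" "finite D" "F = brick ` D"
    by (meson finite_subset_image)
  \<comment> \<open>The sum dominates the length of every chosen label and vanishes off their finite
    supports.\<close>
  define L where "L s = (\<Sum>\<phi>\<in>D. length (\<phi> s))" for s
  have "{s. L s \<noteq> 0} = (\<Union>\<phi>\<in>D. {s. \<phi> s \<noteq> []})"
    using D(2) by (auto simp: L_def)
  then have 1: "finite {s. L s \<noteq> 0}"
    using D by (auto simp: C_def brick_label_def)
  have 2: "\<exists>\<psi> \<gamma>. brick_label \<psi> \<and> \<gamma> \<in> G \<and> realizes h \<rho> \<gamma> \<psi>" if \<rho>: "\<rho> \<in> labels_of L" for \<rho>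
  proof -
    \<comment> \<open>Any sample point of the cell will do: a chosen brick containing it contains
      the whole cell, by the depth of the grid.\<close>
    let ?\<kappa> = "Phi \<rho> (\<lambda>_ _. False)"
    have pre: "\<rho> = pre ?\<kappa> L" by (rule labels_of_eq_pre[OF \<rho>]) simp
    obtain \<phi> where \<phi>: "\<phi> \<in> D" "?\<kappa> \<in> brick \<phi>" using F(3) D(3) by blast
    obtain \<beta> where \<beta>: "\<rho> = lcat \<phi> \<beta>"
      using pre_eq_lcat[OF \<phi>(2), of L] \<phi>(1) D(2) pre
      by (metis (no_types, lifting) L_def member_le_sum zero_le)
    from \<phi>(1) D(1) obtain \<psi> \<gamma> where "brick_label \<psi>" "\<gamma> \<in> G" "realizes h \<phi> \<gamma> \<psi>"
      by (auto simp: C_def)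
    moreover have "brick_label \<rho>"
      using brick_label_pre[OF 1] pre by metis
    ultimately show ?thesis
      using \<beta> realizes_lcat G
      by (intro exI[of _ "lcat \<psi> (lact \<gamma> \<beta>)"] exI[of _ \<gamma>]) (simp add: perm_group_bij)
  qed
  from 1 2 show thesis by (rule that)
qed

text \<open>From right to left, the cells of a sufficiently deep grid form the domain partition and
  their images under \<open>h\<close> the range partition. The local form of \<open>h\<close> and of
  its inverse gives continuity of both.\<close>

lemma SV_iff:
  assumes G: "perm_group G"
  shows "h \<in> SV G \<longleftrightarrow> bij h \<and> locally_twist G h"
proof
  assume "h \<in> SV G"
  then obtain n \<phi> \<psi> \<gamma> where hom: "homeomorphic_map cantorS_top cantorS_top h"
    and p: "brick_partition n \<phi>" "brick_partition n \<psi>"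
    and 1: "\<forall>i<n. \<gamma> i \<in> G" "\<forall>i<n. realizes h (\<phi> i) (\<gamma> i) (\<psi> i)"
    by (auto simp: SV_def realizes_twist)
  have "bij h"
    using homeomorphic_imp_injective_map[OF hom] homeomorphic_imp_surjective_map[OF hom]
    by (simp add: bij_def)
  moreover have "locally_twist G h"
  proof (rule locally_twistI)
    fix \<kappa> :: "'a \<Rightarrow> cantor"
    have "(\<Union>i<n. brick (\<phi> i)) = UNIV" using p(1) by (simp add: brick_partition_def)
    then obtain i where "i < n" "\<kappa> \<in> brick (\<phi> i)" by blast
    then show "\<exists>\<phi> \<psi> \<gamma>. brick_label \<phi> \<and> brick_label \<psi> \<and> \<gamma> \<in> G \<and> \<kappa> \<in> brick \<phi> \<and> realizes h \<phi> \<gamma> \<psi>"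
      using p 1 unfolding brick_partition_def
      by (intro exI[of _ "\<phi> i"] exI[of _ "\<psi> i"] exI[of _ "\<gamma> i"]) simp
  qed
  ultimately show "bij h \<and> locally_twist G h" ..
next
  assume h: "bij h \<and> locally_twist G h"
  have "homeomorphic_maps cantorS_top cantorS_top h (finv h)"
    using h locally_twist_inv[OF G] by (auto simp: homeomorphic_maps_def intro: continuous_locally_twist)
  then have hom: "homeomorphic_map cantorS_top cantorS_top h"
    using homeomorphic_map_maps by blast
  obtain L where L: "finite {s. L s \<noteq> 0}"
    and ex: "\<And>\<rho>. \<rho> \<in> labels_of L \<Longrightarrow> \<exists>\<psi> \<gamma>. brick_label \<psi> \<and> \<gamma> \<in> G \<and> realizes h \<rho> \<gamma> \<psi>"
    using locally_twist_uniform[OF _ G] h by metis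
  from ex obtain \<psi> \<gamma> where \<psi>: "\<And>\<rho>. \<rho> \<in> labels_of L \<Longrightarrow>
      brick_label (\<psi> \<rho>) \<and> \<gamma> \<rho> \<in> G \<and> realizes h \<rho> (\<gamma> \<rho>) (\<psi> \<rho>)"
    by metis
  \<comment> \<open>The definition of \<open>SV\<close> asks for partitions indexed by numbers, so
    the finite grid is enumerated.\<close>
  define n where "n = card (labels_of L)"
  obtain e where "bij_betw e {0..<n} (labels_of L)"
    using ex_bij_betw_nat_finite[OF finite_labels_of[OF L]] unfolding n_def by blast
  then have e: "inj_on e {..<n}" "e ` {..<n} = labels_of L"
    by (auto simp: bij_betw_def lessThan_atLeast0)
  have eU: "e i \<in> labels_of L" if "i < n" for i using e(2) that by blast
  have img: "brick (\<psi> (e i)) = h ` brick (e i)" if "i < n" for i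
    using \<psi>[OF eU[OF that]] realizes_image perm_group_bij[OF G] by metis
  have lab: "brick_label (e i)" if "i < n" for i
    using L eU[OF that] by (simp add: brick_label_length labels_of_def)
  have disj: "brick (e i) \<inter> brick (e j) = {}" if "i < n" "j < n" "i \<noteq> j" for i j
  proof -
    have "e i = e j" if "\<kappa> \<in> brick (e i)" "\<kappa> \<in> brick (e j)" for \<kappa>
      using labels_of_eq_pre[OF eU that(1)] labels_of_eq_pre[OF eU that(2)] \<open>i < n\<close> \<open>j < n\<close> by simp
    then show ?thesis
      using that inj_onD[OF e(1), of i j] by auto
  qed
  have cover: "(\<Union>i<n. brick (e i)) = UNIV"
  proof -
    have "\<exists>i<n. \<kappa> \<in> brick (e i)" for \<kappa>
      using e(2) pre_labels_of[of \<kappa> L] pre_in_brick[of \<kappa> L] by (metis imageE lessThan_iff)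
    then show ?thesis by auto
  qed
  have p1: "brick_partition n e"
    using lab disj cover by (simp add: brick_partition_def)
  have "(\<Union>i<n. brick (\<psi> (e i))) = h ` (\<Union>i<n. brick (e i))"
    using img by auto
  then have "(\<Union>i<n. brick (\<psi> (e i))) = UNIV"
    using cover h by (simp add: bij_is_surj)
  moreover have "brick (\<psi> (e i)) \<inter> brick (\<psi> (e j)) = {}" if "i < n" "j < n" "i \<noteq> j" for i j
    using disj[OF that] img that h by (metis bij_is_inj image_Int image_empty)
  ultimately have p2: "brick_partition n (\<lambda>i. \<psi> (e i))"
    using \<psi> eU by (simp add: brick_partition_def)
  have "\<forall>i<n. \<gamma> (e i) \<in> G" "\<forall>i<n. \<forall>\<kappa>\<in>brick (e i). h \<kappa> = twist (e i) (\<psi> (e i)) (\<gamma> (e i)) \<kappa>"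
    unfolding realizes_twist using \<psi> eU by auto
  then show "h \<in> SV G"
    unfolding SV_def using hom p1 p2
    by (intro CollectI conjI exI[of _ n] exI[of _ e] exI[of _ "\<lambda>i. \<psi> (e i)"]
        exI[of _ "\<lambda>i. \<gamma> (e i)"]) simp_all
qed

lemma perm_group_SV: "perm_group G \<Longrightarrow> perm_group (SV G)"
  using perm_group_locally_twist[of G] SV_iff[of G] by (simp add: set_eq_iff perm_group_def)

section \<open>Subdividing brick partitions\<close>

text \<open>Unique existence combines covering and disjointness. Since bricks are nonempty, distinct
  labels in \<open>P\<close> also have distinct bricks.\<close>

definition lpart :: "('s \<Rightarrow> bool list) set \<Rightarrow> bool" where
  "lpart P \<longleftrightarrow> finite P \<and> (\<forall>\<phi>\<in>P. brick_label \<phi>) \<and> (\<forall>\<kappa>. \<exists>!\<phi>. \<phi> \<in> P \<and> \<kappa> \<in> brick \<phi>)"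

definition split_at :: "('s \<Rightarrow> bool list) \<Rightarrow> 's \<Rightarrow> ('s \<Rightarrow> bool list) set \<Rightarrow> ('s \<Rightarrow> bool list) set" where
  "split_at \<phi> s P = insert (ext \<phi> s False) (insert (ext \<phi> s True) (P - {\<phi>}))"

definition split :: "('s \<Rightarrow> bool list) set \<Rightarrow> ('s \<Rightarrow> bool list) set \<Rightarrow> bool" where
  "split P Q \<longleftrightarrow> (\<exists>\<phi>\<in>P. \<exists>s. Q = split_at \<phi> s P)"

text \<open>The map \<open>f\<close> records where \<open>h\<close> sends each brick. For bijective
  \<open>h\<close>, a partition \<open>P\<close> and a group \<open>G\<close> it is injective, so
  \<open>P\<close> and \<open>Q\<close> have equal size.\<close>

definition matches :: "('s \<Rightarrow> 's) set \<Rightarrow> (('s \<Rightarrow> cantor) \<Rightarrow> ('s \<Rightarrow> cantor))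
    \<Rightarrow> ('s \<Rightarrow> bool list) set \<Rightarrow> ('s \<Rightarrow> bool list) set \<Rightarrow> bool" where
  "matches G h P Q \<longleftrightarrow> (\<exists>f \<gamma>. f ` P = Q \<and> (\<forall>\<phi>\<in>P. \<gamma> \<phi> \<in> G \<and> realizes h \<phi> (\<gamma> \<phi>) (f \<phi>)))"

lemma lpart_finite: "lpart P \<Longrightarrow> finite P"
  and lpart_label: "lpart P \<Longrightarrow> \<phi> \<in> P \<Longrightarrow> brick_label \<phi>"
  and lpart_cover: "lpart P \<Longrightarrow> \<exists>\<phi>\<in>P. \<kappa> \<in> brick \<phi>"
  and lpart_unique: "lpart P \<Longrightarrow> \<phi> \<in> P \<Longrightarrow> \<psi> \<in> P \<Longrightarrow> \<kappa> \<in> brick \<phi> \<Longrightarrow> \<kappa> \<in> brick \<psi> \<Longrightarrow> \<phi> = \<psi>"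
  by (auto simp: lpart_def)

lemma lpart_apart: "lpart P \<Longrightarrow> \<phi> \<in> P \<Longrightarrow> \<psi> \<in> P \<Longrightarrow> \<phi> \<noteq> \<psi> \<Longrightarrow> apart \<phi> \<psi>"
  using lpart_unique unfolding apart_def by blast

lemma lpart_lnil: "lpart {lnil}"
  by (auto simp: lpart_def intro!: ex1I[of _ lnil])

lemma brick_ext_iff: "\<kappa> \<in> brick (ext \<phi> s a) \<longleftrightarrow> \<kappa> \<in> brick \<phi> \<and> \<kappa> s (length (\<phi> s)) = a"
proof (cases "\<kappa> \<in> brick \<phi>")
  case True
  then obtain x where "\<kappa> = Phi \<phi> x" by (rule brickE)
  then show ?thesis
    by (simp add: in_brick_single_iff) (simp add: Phi_def wcat_def)
qed (use brick_lcat_subset in blast)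

lemma ext_notin_lpart:
  assumes "lpart P" "\<phi> \<in> P"
  shows "ext \<phi> s a \<notin> P"
proof
  assume *: "ext \<phi> s a \<in> P"
  have "Phi (ext \<phi> s a) (\<lambda>_ _. False) \<in> brick \<phi>"
    using brick_lcat_subset Phi_in_brick by blast
  then have "ext \<phi> s a = \<phi>"
    using lpart_unique[OF assms(1) * assms(2)] Phi_in_brick by blast
  then show False by (simp add: ext_neq)
qed

lemma notin_split_at: "\<phi> \<notin> split_at \<phi> s P"
  unfolding split_at_def by (metis Diff_iff ext_neq insertE singletonI)

lemma ext_eq_iff: "ext \<phi> s a = ext \<phi> s b \<longleftrightarrow> a = b"
  by (auto simp: lcat_def single_def fun_eq_iff dest!: spec[of _ s])

lemma split_at_lpart:
  assumes P: "lpart P" and \<phi>: "\<phi> \<in> P"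
  shows "lpart (split_at \<phi> s P)" "card (split_at \<phi> s P) = Suc (card P)"
proof -
  have "\<exists>!\<psi>. \<psi> \<in> split_at \<phi> s P \<and> \<kappa> \<in> brick \<psi>" for \<kappa>
  proof -
    obtain \<psi> where \<psi>: "\<psi> \<in> P" "\<kappa> \<in> brick \<psi>" using lpart_cover[OF P] by blast
    have u: "\<rho> = \<psi>" if "\<rho> \<in> P" "\<kappa> \<in> brick \<rho>" for \<rho>
      using lpart_unique[OF P that(1) \<psi>(1) that(2) \<psi>(2)] .
    show ?thesis
    proof (cases "\<psi> = \<phi>")
      case True
      show ?thesis
      proof (rule ex1I[of _ "ext \<phi> s (\<kappa> s (length (\<phi> s)))"])
        show "ext \<phi> s (\<kappa> s (length (\<phi> s))) \<in> split_at \<phi> s P \<and>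
            \<kappa> \<in> brick (ext \<phi> s (\<kappa> s (length (\<phi> s))))"
          using \<psi> True by (cases "\<kappa> s (length (\<phi> s))") (simp_all add: split_at_def brick_ext_iff)
      next
        fix \<rho> assume \<rho>: "\<rho> \<in> split_at \<phi> s P \<and> \<kappa> \<in> brick \<rho>"
        then have "\<rho> \<notin> P - {\<phi>}" using u[of \<rho>] True by simp
        with \<rho> obtain a where "\<rho> = ext \<phi> s a" unfolding split_at_def by blast
        with \<rho> show "\<rho> = ext \<phi> s (\<kappa> s (length (\<phi> s)))" by (simp add: brick_ext_iff)
      qed
    next
      case False
      then have "\<kappa> \<notin> brick \<phi>" using u[OF \<phi>] by auto
      then have iff: "\<rho> \<in> split_at \<phi> s P \<and> \<kappa> \<in> brick \<rho> \<longleftrightarrow> \<rho> \<in> P - {\<phi>} \<and> \<kappa> \<in> brick \<rho>" for \<rho>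
        unfolding split_at_def by (metis Diff_iff brick_ext_iff insertE insertI1 insertI2 insert_iff)
      show ?thesis
        unfolding iff
      proof (rule ex1I[of _ \<psi>])
        show "\<psi> \<in> P - {\<phi>} \<and> \<kappa> \<in> brick \<psi>" using \<psi> False by blast
        show "\<rho> \<in> P - {\<phi>} \<and> \<kappa> \<in> brick \<rho> \<Longrightarrow> \<rho> = \<psi>" for \<rho> using u[of \<rho>] by blast
      qed
    qed
  qed
  moreover have "finite (split_at \<phi> s P)"
    using lpart_finite[OF P] by (simp add: split_at_def)
  moreover have "\<forall>\<psi>\<in>split_at \<phi> s P. brick_label \<psi>"
    using lpart_label[OF P] \<phi> by (simp add: split_at_def)
  ultimately show "lpart (split_at \<phi> s P)" by (simp add: lpart_def)
  show "card (split_at \<phi> s P) = Suc (card P)"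
    using ext_notin_lpart[OF P \<phi>] lpart_finite[OF P] card_Suc_Diff1[OF lpart_finite[OF P] \<phi>]
    by (simp add: split_at_def ext_eq_iff)
qed

lemma split_lpart: "lpart P \<Longrightarrow> split P Q \<Longrightarrow> lpart Q \<and> card Q = Suc (card P)"
  using split_at_lpart by (auto simp: split_def)

lemma splits_lpart: "split\<^sup>*\<^sup>* P Q \<Longrightarrow> lpart P \<Longrightarrow> lpart Q"
  by (induction rule: rtranclp_induct) (use split_lpart in blast)+

lemma splits_card: "(split ^^ n) P Q \<Longrightarrow> lpart P \<Longrightarrow> lpart Q \<and> card Q = card P + n"
proof (induction n arbitrary: Q)
  case (Suc n)
  from Suc.prems(1) obtain R where "(split ^^ n) P R" "split R Q" by auto
  then show ?case using Suc split_lpart[of R Q] by simp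
qed simp

text \<open>Labels that are too short are halved in a missing direction. Each label weighs
  \<open>3\<close> to the number of its missing letters; a halving replaces \<open>3 ^ Suc m\<close>
  by twice \<open>3 ^ m\<close>, so the total weight drops.\<close>

lemma splits_uniform:
  assumes "lpart P" "\<forall>\<phi>\<in>P. \<forall>s. length (\<phi> s) \<le> L s" "finite {s. L s \<noteq> 0}"
  shows "split\<^sup>*\<^sup>* P (labels_of L)"
  using assms(1,2)
proof (induction "\<Sum>\<phi>\<in>P. (3::nat) ^ (\<Sum>s | L s \<noteq> 0. L s - length (\<phi> s))" arbitrary: P rule: less_induct)
  case less
  let ?m = "\<lambda>\<phi>. \<Sum>s | L s \<noteq> 0. L s - length (\<phi> s)"
  show ?case
  proof (cases "P \<subseteq> labels_of L")
    case True
    \<comment> \<open>A partition into cells of the grid contains each cell, because the member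
      covering a point of the cell must be that cell.\<close>
    have "\<phi> \<in> P" if \<phi>: "\<phi> \<in> labels_of L" for \<phi>
    proof -
      let ?\<kappa> = "Phi \<phi> (\<lambda>_ _. False)"
      obtain \<psi> where "\<psi> \<in> P" "?\<kappa> \<in> brick \<psi>" using lpart_cover[OF less.prems(1)] by blast
      then show ?thesis
        using labels_of_eq_pre[of \<psi> L ?\<kappa>] labels_of_eq_pre[OF \<phi>, of ?\<kappa>] True by auto
    qed
    then have "P = labels_of L" using True by blast
    then show ?thesis by simp
  next
    case False
    then obtain \<phi> s where \<phi>: "\<phi> \<in> P" "length (\<phi> s) \<noteq> L s"
      by (auto simp: labels_of_def)
    with less.prems have lt: "length (\<phi> s) < L s" by (simp add: le_neq_implies_less)
    let ?Q = "split_at \<phi> s P"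
    have len: "length (ext \<phi> s a t) = length (\<phi> t) + (if t = s then 1 else 0)" for a t
      by (simp add: lcat_def single_def)
    have m: "?m \<phi> = Suc (?m (ext \<phi> s a))" for a
    proof -
      have *: "?m \<psi> = (L s - length (\<psi> s)) + (\<Sum>t\<in>{s. L s \<noteq> 0} - {s}. L t - length (\<psi> t))" for \<psi> :: "'a \<Rightarrow> bool list"
        using lt assms(3) by (subst sum.remove[of _ s]) auto
      have **: "(\<Sum>t\<in>{s. L s \<noteq> 0} - {s}. L t - length (ext \<phi> s a t))
          = (\<Sum>t\<in>{s. L s \<noteq> 0} - {s}. L t - length (\<phi> t))"
        by (rule sum.cong) (auto simp: len)
      show ?thesis
        unfolding *[of \<phi>] *[of "ext \<phi> s a"] unfolding ** len using lt by simp
    qed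
    have "(\<Sum>\<psi>\<in>?Q. (3::nat) ^ ?m \<psi>) =
        3 ^ ?m (ext \<phi> s False) + (3 ^ ?m (ext \<phi> s True) + (\<Sum>\<psi>\<in>P - {\<phi>}. 3 ^ ?m \<psi>))"
      using ext_notin_lpart[OF less.prems(1) \<phi>(1)] lpart_finite[OF less.prems(1)]
      unfolding split_at_def by (simp add: ext_eq_iff)
    also have "\<dots> < 3 ^ ?m \<phi> + (\<Sum>\<psi>\<in>P - {\<phi>}. 3 ^ ?m \<psi>)"
      using m[of True] m[of False] by simp
    also have "\<dots> = (\<Sum>\<psi>\<in>P. 3 ^ ?m \<psi>)"
      using \<phi>(1) lpart_finite[OF less.prems(1)] by (simp add: sum.remove)
    finally have "(\<Sum>\<psi>\<in>?Q. (3::nat) ^ ?m \<psi>) < (\<Sum>\<psi>\<in>P. 3 ^ ?m \<psi>)" .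
    moreover have "\<forall>\<psi>\<in>?Q. \<forall>t. length (\<psi> t) \<le> L t"
      using less.prems(2) \<phi>(1) lt by (auto simp: split_at_def len Suc_le_eq)
    ultimately have "split\<^sup>*\<^sup>* ?Q (labels_of L)"
      using less.hyps split_at_lpart(1)[OF less.prems(1) \<phi>(1)] by blast
    moreover have "split P ?Q" using \<phi>(1) by (auto simp: split_def)
    ultimately show ?thesis by (rule converse_rtranclp_into_rtranclp[rotated])
  qed
qed

lemma lpart_bound:
  assumes "lpart P"
  obtains L where "finite {s. L s \<noteq> 0}" "\<forall>\<phi>\<in>P. \<forall>s. length (\<phi> s) \<le> L s"
proof
  let ?L = "\<lambda>s. \<Sum>\<phi>\<in>P. length (\<phi> s)"
  have "{s. ?L s \<noteq> 0} = (\<Union>\<phi>\<in>P. {s. \<phi> s \<noteq> []})"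
    using lpart_finite[OF assms] by auto
  then show "finite {s. ?L s \<noteq> 0}"
    using assms by (auto simp: lpart_def brick_label_def)
  show "\<forall>\<phi>\<in>P. \<forall>s. length (\<phi> s) \<le> ?L s"
    using lpart_finite[OF assms] by (auto intro: member_le_sum)
qed

section \<open>Transport of partitions and their subdivisions\<close>

lemma realizes_inj_on:
  assumes "lpart P" "bij h" "\<And>\<phi>. \<phi> \<in> P \<Longrightarrow> bij (\<gamma> \<phi>) \<and> realizes h \<phi> (\<gamma> \<phi>) (f \<phi>)"
  shows "inj_on f P"
proof (rule inj_onI)
  fix \<phi> \<psi> assume *: "\<phi> \<in> P" "\<psi> \<in> P" "f \<phi> = f \<psi>"
  then have "h ` brick \<phi> = h ` brick \<psi>"
    using assms(3) realizes_image by metis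
  then have "brick \<phi> = brick \<psi>"
    using assms(2) by (simp add: bij_is_inj inj_image_eq_iff)
  then show "\<phi> = \<psi>"
    using lpart_unique[OF assms(1) *(1,2)] Phi_in_brick by metis
qed

lemma realizes_lpart:
  assumes "lpart P" "bij h"
    and f: "\<And>\<phi>. \<phi> \<in> P \<Longrightarrow> bij (\<gamma> \<phi>) \<and> realizes h \<phi> (\<gamma> \<phi>) (f \<phi>) \<and> brick_label (f \<phi>)"
  shows "lpart (f ` P)"
proof -
  have in_iff: "\<kappa> \<in> brick (f \<phi>) \<longleftrightarrow> finv h \<kappa> \<in> brick \<phi>" if "\<phi> \<in> P" for \<phi> \<kappa>
    using realizes_in_brick_iff[of h \<phi> "\<gamma> \<phi>" "f \<phi>" "finv h \<kappa>"] f[OF that] assms(2) by simp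
  have "\<exists>!\<psi>. \<psi> \<in> f ` P \<and> \<kappa> \<in> brick \<psi>" for \<kappa>
  proof -
    obtain \<phi> where \<phi>: "\<phi> \<in> P" "finv h \<kappa> \<in> brick \<phi>" using lpart_cover[OF assms(1)] by blast
    moreover have "\<phi>' = \<phi>" if "\<phi>' \<in> P" "\<kappa> \<in> brick (f \<phi>')" for \<phi>'
      using lpart_unique[OF assms(1) that(1) \<phi>(1) _ \<phi>(2)] in_iff[OF that(1)] that(2) by blast
    moreover have "f \<phi> \<in> f ` P \<and> \<kappa> \<in> brick (f \<phi>)" using in_iff[OF \<phi>(1)] \<phi> by blast
    ultimately show ?thesis by blast
  qed
  then show ?thesis
    using f lpart_finite[OF assms(1)] by (auto simp: lpart_def)
qed

lemma realizes_ext_unique: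
  assumes "lpart P" "\<And>\<phi>. \<phi> \<in> P \<Longrightarrow> realizes h \<phi> (\<gamma> \<phi>) (f \<phi>)"
    "\<And>\<phi>. \<phi> \<in> P \<Longrightarrow> realizes k \<phi> (\<gamma> \<phi>) (f \<phi>)"
  shows "h = k"
proof
  fix \<kappa>
  obtain \<phi> where \<phi>: "\<phi> \<in> P" "\<kappa> \<in> brick \<phi>" using lpart_cover[OF assms(1)] by blast
  then obtain x where "\<kappa> = Phi \<phi> x" by (auto elim: brickE)
  then show "h \<kappa> = k \<kappa>"
    using realizesD[OF assms(2)[OF \<phi>(1)]] realizesD[OF assms(3)[OF \<phi>(1)]] by simp
qed

text \<open>Halving a brick in direction \<open>t\<close> halves its image in direction
  \<open>\<gamma> \<phi> t\<close>, because the twist carries coordinate \<open>t\<close>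
  there.\<close>

lemma matches_split:
  assumes P: "lpart P" and h: "bij h" and G: "perm_group G"
    and m: "matches G h P Q" and s: "split P P'"
  shows "\<exists>Q'. split Q Q' \<and> matches G h P' Q'"
proof -
  obtain f \<gamma> where f: "f ` P = Q" "\<And>\<phi>. \<phi> \<in> P \<Longrightarrow> \<gamma> \<phi> \<in> G \<and> realizes h \<phi> (\<gamma> \<phi>) (f \<phi>)"
    using m by (auto simp: matches_def)
  have bij: "bij (\<gamma> \<phi>)" if "\<phi> \<in> P" for \<phi> using f(2)[OF that] G by (simp add: perm_group_bij)
  have inj: "inj_on f P"
    using realizes_inj_on[OF P h] f(2) bij by blast
  obtain \<phi> t where \<phi>: "\<phi> \<in> P" "P' = split_at \<phi> t P" using s by (auto simp: split_def)
  let ?Q = "split_at (f \<phi>) (\<gamma> \<phi> t) Q"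
  \<comment> \<open>The members of \<open>P'\<close> outside \<open>P\<close> are the two halves of
    \<phi>; the comparison with \<open>ext \<phi> t True\<close> recovers the added bit.\<close>
  let ?f = "\<lambda>\<psi>. if \<psi> \<in> P then f \<psi> else ext (f \<phi>) (\<gamma> \<phi> t) (\<psi> = ext \<phi> t True)"
  let ?\<gamma> = "\<lambda>\<psi>. if \<psi> \<in> P then \<gamma> \<psi> else \<gamma> \<phi>"
  have new: "ext \<phi> t a \<notin> P" for a using ext_notin_lpart[OF P \<phi>(1)] .
  have "?f ` P' = ?Q"
  proof -
    have "f ` (P - {\<phi>}) = Q - {f \<phi>}"
      using inj \<phi>(1) f(1) by (auto simp: inj_on_def)
    moreover have "?f ` (P - {\<phi>}) = f ` (P - {\<phi>})" by (rule image_cong) auto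
    moreover have "?f (ext \<phi> t a) = ext (f \<phi>) (\<gamma> \<phi> t) a" for a
      using new[of a] by (simp add: ext_eq_iff)
    ultimately show ?thesis
      unfolding \<phi>(2) split_at_def image_insert by presburger
  qed
  moreover have "?\<gamma> \<psi> \<in> G \<and> realizes h \<psi> (?\<gamma> \<psi>) (?f \<psi>)" if \<psi>: "\<psi> \<in> P'" for \<psi>
  proof (cases "\<psi> \<in> P")
    case False
    then obtain a where a: "\<psi> = ext \<phi> t a"
      using \<psi> by (auto simp: \<phi>(2) split_at_def)
    then show ?thesis
      using False f(2)[OF \<phi>(1)] realizes_ext[of h \<phi> "\<gamma> \<phi>" "f \<phi>" t a] bij[OF \<phi>(1)]
      by (simp add: ext_eq_iff)
  qed (use f(2) in simp)
  ultimately have "matches G h P' ?Q"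
    unfolding matches_def by (intro exI[of _ ?f] exI[of _ ?\<gamma>]) blast
  moreover have "split Q ?Q" using f(1) \<phi>(1) by (auto simp: split_def)
  ultimately show ?thesis by blast
qed

lemma matches_splits:
  assumes "split\<^sup>*\<^sup>* P P'" "lpart P" "bij h" "perm_group G" "matches G h P Q"
  shows "\<exists>Q'. split\<^sup>*\<^sup>* Q Q' \<and> matches G h P' Q'"
  using assms(1)
proof (induction rule: rtranclp_induct)
  case base
  then show ?case using assms(5) by blast
next
  case (step P1 P2)
  then obtain Q1 where "split\<^sup>*\<^sup>* Q Q1" "matches G h P1 Q1" by blast
  moreover obtain Q2 where "split Q1 Q2" "matches G h P2 Q2"
    using matches_split[OF splits_lpart[OF step(1) assms(2)] assms(3,4)] step(2) calculation by blast
  ultimately show ?case by (meson rtranclp.rtrancl_into_rtrancl)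
qed

lemma matches_inv:
  assumes "lpart P" "bij h" "perm_group G" "matches G h P Q"
  shows "matches G (finv h) Q P"
proof -
  obtain f \<gamma> where f: "f ` P = Q" "\<And>\<phi>. \<phi> \<in> P \<Longrightarrow> \<gamma> \<phi> \<in> G \<and> realizes h \<phi> (\<gamma> \<phi>) (f \<phi>)"
    using assms(4) by (auto simp: matches_def)
  have inj: "inj_on f P"
    by (rule realizes_inj_on[OF assms(1,2), of \<gamma>]) (use f(2) assms(3) in \<open>simp add: perm_group_bij\<close>)
  let ?g = "inv_into P f"
  have "?g ` Q = P" using inj f(1) by auto
  moreover have "finv (\<gamma> (?g \<psi>)) \<in> G \<and> realizes (finv h) \<psi> (finv (\<gamma> (?g \<psi>))) (?g \<psi>)" if \<psi>: "\<psi> \<in> Q" for \<psi>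
  proof -
    obtain \<phi> where \<phi>: "\<phi> \<in> P" "\<psi> = f \<phi>" using \<psi> f(1) by blast
    with inj have "?g \<psi> = \<phi>" by simp
    then show ?thesis
      using f(2)[OF \<phi>(1)] realizes_inv[OF _ assms(2)] \<phi>(2) assms(3)
      by (simp add: perm_group_inv perm_group_bij)
  qed
  ultimately show ?thesis
    unfolding matches_def by (intro exI[of _ ?g] exI[of _ "\<lambda>\<psi>. finv (\<gamma> (?g \<psi>))"]) simp
qed

section \<open>A criterion for containing the twisted Brin--Thompson group\<close>

text \<open>The three kinds of elements have separate duties: swaps permute the bricks of a
  partition, local permutations install twists, and local baker maps change the direction of a
  halving.\<close>

locale swap_closed =
  fixes \<Gamma> :: "(('s \<Rightarrow> cantor) \<Rightarrow> ('s \<Rightarrow> cantor)) set" and G :: "('s \<Rightarrow> 's) set"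
  assumes \<Gamma>: "perm_group \<Gamma>" and G: "perm_group G"
    and loc_tau_closed: "brick_label \<phi> \<Longrightarrow> \<gamma> \<in> G \<Longrightarrow> loc \<phi> (tau \<gamma>) \<in> \<Gamma>"
    and loc_bk_closed: "brick_label \<phi> \<Longrightarrow> loc \<phi> (bk s t) \<in> \<Gamma>"
    and sw_closed: "brick_label \<phi> \<Longrightarrow> brick_label \<psi> \<Longrightarrow> apart \<phi> \<psi> \<Longrightarrow> sw \<phi> \<psi> \<in> \<Gamma>"
begin

text \<open>A permutation of a finite set is a product of transpositions, and the swap of two bricks
  fixes all other bricks of the partition.\<close>

lemma realize_permutation:
  assumes P: "lpart P" and p: "p permutes P"
  shows "\<exists>g\<in>\<Gamma>. \<forall>\<phi>\<in>P. realizes g \<phi> id (p \<phi>)"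
  using p lpart_finite[OF P]
proof (induction rule: permutes_induct)
  case id
  then show ?case using perm_group_id[OF \<Gamma>] realizes_id by (metis id_apply)
next
  case (swap a b p)
  then obtain g where g: "g \<in> \<Gamma>" "\<And>\<phi>. \<phi> \<in> P \<Longrightarrow> realizes g \<phi> id (p \<phi>)" by blast
  have dab: "apart a b" using swap lpart_apart[OF P] by blast
  have "sw a b \<in> \<Gamma>"
    using sw_closed lpart_label[OF P] swap dab by blast
  then have "sw a b \<circ> g \<in> \<Gamma>" using g(1) perm_group_comp[OF \<Gamma>] by blast
  moreover have "realizes (sw a b) \<psi> id (Transposition.transpose a b \<psi>)" if "\<psi> \<in> P" for \<psi>
  proof -
    consider "\<psi> = a" | "\<psi> = b" | "\<psi> \<noteq> a" "\<psi> \<noteq> b" by blast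
    then show ?thesis
    proof cases
      case 3
      then have "apart a \<psi>" "apart b \<psi>" using swap that lpart_apart[OF P] by blast+
      with 3 show ?thesis by (simp add: transpose_def realizes_sw_apart)
    qed (use dab in \<open>simp_all add: realizes_sw1 realizes_sw2\<close>)
  qed
  then have "realizes (sw a b \<circ> g) \<phi> id ((Transposition.transpose a b \<circ> p) \<phi>)" if "\<phi> \<in> P" for \<phi>
    using realizes_comp[OF g(2)[OF that] _ bij_id bij_id] permutes_in_image[OF swap.hyps(4)] that
    by (metis comp_apply comp_id)
  ultimately show ?case by blast
qed

lemma realize_twists:
  assumes P: "lpart P" and \<gamma>: "\<And>\<phi>. \<phi> \<in> P \<Longrightarrow> \<gamma> \<phi> \<in> G"
  shows "\<exists>g\<in>\<Gamma>. \<forall>\<phi>\<in>P. realizes g \<phi> (\<gamma> \<phi>) \<phi>"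
proof -
  have "\<exists>g\<in>\<Gamma>. \<forall>\<phi>\<in>P. realizes g \<phi> (if \<phi> \<in> D then \<gamma> \<phi> else id) \<phi>" if "finite D" "D \<subseteq> P" for D
    using that
  proof (induction rule: finite_induct)
    case empty
    then show ?case using perm_group_id[OF \<Gamma>] realizes_id by (metis empty_iff)
  next
    case (insert \<psi> D)
    then obtain g where g: "g \<in> \<Gamma>" "\<And>\<phi>. \<phi> \<in> P \<Longrightarrow> realizes g \<phi> (if \<phi> \<in> D then \<gamma> \<phi> else id) \<phi>"
      by auto
    let ?l = "loc \<psi> (tau (\<gamma> \<psi>))"
    have "?l \<circ> g \<in> \<Gamma>"
      using g(1) insert.prems \<gamma> loc_tau_closed lpart_label[OF P] perm_group_comp[OF \<Gamma>] by simp
    moreover have "realizes (?l \<circ> g) \<phi> (if \<phi> \<in> insert \<psi> D then \<gamma> \<phi> else id) \<phi>" if \<phi>: "\<phi> \<in> P" for \<phi>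
    proof (cases "\<phi> = \<psi>")
      case True
      with g(2)[OF \<phi>] insert.hyps(2) have "realizes g \<psi> id \<psi>" by simp
      then show ?thesis
        using realizes_comp[OF _ realizes_loc_tau[of \<psi> "\<gamma> \<psi>"] bij_id] perm_group_bij[OF G \<gamma>[OF \<phi>]] True
        by force
    next
      case False
      then have "realizes ?l \<phi> id \<phi>"
        using realizes_loc_apart lpart_apart[OF P] \<phi> insert.prems by (metis insert_subset)
      moreover have "bij (if \<phi> \<in> D then \<gamma> \<phi> else id)"
        using perm_group_bij[OF G \<gamma>[OF \<phi>]] by simp
      ultimately show ?thesis
        using realizes_comp[OF g(2)[OF \<phi>]] False by force
    qed
    ultimately show ?case by blast
  qed
  from this[OF lpart_finite[OF P]] show ?thesis by auto
qed

text \<open>Before splitting, a permutation aligns the two bricks to be split; a local baker map then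
  corrects the direction of the split.\<close>
lemma realize_splits:
  "(split ^^ n) {lnil} P \<Longrightarrow> (split ^^ n) {lnil} Q \<Longrightarrow>
    \<exists>g\<in>\<Gamma>. \<exists>f. f ` P = Q \<and> (\<forall>\<phi>\<in>P. realizes g \<phi> id (f \<phi>))"
proof (induction n arbitrary: P Q)
  case 0
  then have "(\<lambda>\<phi>. \<phi>) ` P = Q" by simp
  moreover have "\<forall>\<phi>\<in>P. realizes id \<phi> id \<phi>"
    using realizes_id by blast
  ultimately show ?case
    using perm_group_id[OF \<Gamma>] by blast
next
  case (Suc n)
  obtain P0 Q0 where 0: "(split ^^ n) {lnil} P0" "split P0 P" "(split ^^ n) {lnil} Q0" "split Q0 Q"
    using Suc.prems by auto
  have P0: "lpart P0" and Q0: "lpart Q0" using 0 splits_card[OF _ lpart_lnil] by blast+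
  obtain \<phi> s where \<phi>: "\<phi> \<in> P0" "P = split_at \<phi> s P0" using 0(2) by (auto simp: split_def)
  obtain \<psi> t where \<psi>: "\<psi> \<in> Q0" "Q = split_at \<psi> t Q0" using 0(4) by (auto simp: split_def)
  obtain g f where g: "g \<in> \<Gamma>" "f ` P0 = Q0" "\<And>\<phi>. \<phi> \<in> P0 \<Longrightarrow> realizes g \<phi> id (f \<phi>)"
    using Suc.IH[OF 0(1,3)] by blast
  have "inj_on f P0"
    using realizes_inj_on[OF P0 perm_group_bij[OF \<Gamma> g(1)], of "\<lambda>_. id"] g(3) bij_id by blast
  \<comment> \<open>\<open>g\<close> may send \<phi> to a brick of \<open>Q0\<close> other than
    \<psi>; the transposition redirects it to \<psi>, the brick to be halved.\<close>
  let ?p = "Transposition.transpose (f \<phi>) \<psi>"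
  have p: "?p permutes Q0"
    using g(2) \<phi>(1) \<psi>(1) by (intro permutes_swap_id) auto
  obtain g' where g': "g' \<in> \<Gamma>" "\<And>\<rho>. \<rho> \<in> Q0 \<Longrightarrow> realizes g' \<rho> id (?p \<rho>)"
    using realize_permutation[OF Q0 p] by blast
  let ?b = "loc \<psi> (bk s t)"
  let ?h = "?b \<circ> (g' \<circ> g)"
  have "?b \<in> \<Gamma>" using loc_bk_closed lpart_label[OF Q0] \<psi>(1) by blast
  then have h: "?h \<in> \<Gamma>" using g(1) g'(1) perm_group_comp[OF \<Gamma>] by blast
  have gg: "realizes (g' \<circ> g) \<rho> id (?p (f \<rho>))" if "\<rho> \<in> P0" for \<rho>
    using realizes_comp[OF g(3)[OF that] g'(2) bij_id bij_id] g(2) that by auto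
  \<comment> \<open>The corrected matching is kept on the old bricks; only the halves of \<phi> are
    new, and they go to the halves of \<psi> with the same bit.\<close>
  let ?f = "\<lambda>\<rho>. if \<rho> \<in> P0 then ?p (f \<rho>) else ext \<psi> t (\<rho> = ext \<phi> s True)"
  have new: "ext \<phi> s a \<notin> P0" for a using ext_notin_lpart[OF P0 \<phi>(1)] .
  have ne: "?p (f \<rho>) \<noteq> \<psi>" if "\<rho> \<in> P0" "\<rho> \<noteq> \<phi>" for \<rho>
    using \<open>inj_on f P0\<close> that \<phi>(1) by (auto simp: transpose_eq_iff inj_on_def)
  have "realizes ?h \<rho> id (?f \<rho>)" if \<rho>: "\<rho> \<in> P" for \<rho>
  proof (cases "\<rho> \<in> P0")
    case True
    then have "\<rho> \<noteq> \<phi>" using \<rho> unfolding \<phi>(2) by (metis notin_split_at)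
    then have "apart \<psi> (?p (f \<rho>))"
      using ne[OF True] lpart_apart[OF Q0 \<psi>(1)] permutes_in_image[OF p] g(2) True by (metis imageI)
    then have "realizes ?b (?p (f \<rho>)) id (?p (f \<rho>))" by (rule realizes_loc_apart)
    from realizes_comp[OF gg[OF True] this] show ?thesis using True by simp
  next
    case False
    then obtain a where a: "\<rho> = ext \<phi> s a"
      using \<rho> by (auto simp: \<phi>(2) split_at_def)
    have "realizes (g' \<circ> g) \<phi> id \<psi>" using gg[OF \<phi>(1)] by simp
    from realizes_ext[OF this bij_id, of s a]
    have "realizes (g' \<circ> g) \<rho> id (ext \<psi> s a)" using a by simp
    from realizes_comp[OF this realizes_loc[OF realizes_bk]] show ?thesis
      using False a by (simp add: ext_eq_iff)
  qed
  moreover have "?f ` P = Q"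
  proof -
    have "(\<lambda>\<rho>. ?p (f \<rho>)) ` P0 = Q0"
      using permutes_image[OF p] g(2) by (metis image_image)
    then have "(\<lambda>\<rho>. ?p (f \<rho>)) ` (P0 - {\<phi>}) = Q0 - {\<psi>}"
      using ne \<phi>(1) by auto
    moreover have "?f ` (P0 - {\<phi>}) = (\<lambda>\<rho>. ?p (f \<rho>)) ` (P0 - {\<phi>})" by (rule image_cong) auto
    moreover have "?f (ext \<phi> s a) = ext \<psi> t a" for a
      using new[of a] by (simp add: ext_eq_iff)
    ultimately show ?thesis
      unfolding \<phi>(2) \<psi>(2) split_at_def image_insert by presburger
  qed
  ultimately show ?case using h by blast
qed

text \<open>Refining the range of \<open>h\<close> to a grid and pulling back gives partitions
  \<open>R\<close> and \<open>?U\<close> of equal size, both obtained from the whole space by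
  halvings. An element of \<Gamma> matches them untwisted; twists on the bricks of \<open>?U\<close>
  and a permutation of these bricks turn it into \<open>h\<close>.\<close>

lemma SV_subset: "SV G \<subseteq> \<Gamma>"
proof
  fix h assume "h \<in> SV G"
  then have h: "bij h" "locally_twist G h" by (simp_all add: SV_iff[OF G])
  obtain L where L: "finite {s. L s \<noteq> 0}"
    and ex: "\<And>\<rho>. \<rho> \<in> labels_of L \<Longrightarrow> \<exists>\<psi> \<gamma>. brick_label \<psi> \<and> \<gamma> \<in> G \<and> realizes h \<rho> \<gamma> \<psi>"
    using locally_twist_uniform[OF h(2) G] by metis
  let ?P = "labels_of L"
  have sP: "split\<^sup>*\<^sup>* {lnil} ?P" by (rule splits_uniform[OF lpart_lnil]) (use L in simp_all)
  then have P: "lpart ?P" using splits_lpart lpart_lnil by blast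
  from ex obtain \<psi> \<gamma> where \<psi>: "\<And>\<rho>. \<rho> \<in> ?P \<Longrightarrow>
      brick_label (\<psi> \<rho>) \<and> \<gamma> \<rho> \<in> G \<and> realizes h \<rho> (\<gamma> \<rho>) (\<psi> \<rho>)"
    by metis
  have Q: "lpart (\<psi> ` ?P)"
    by (rule realizes_lpart[OF P h(1), of \<gamma>]) (use \<psi> perm_group_bij[OF G] in blast)
  have m: "matches G h ?P (\<psi> ` ?P)" using \<psi> unfolding matches_def by blast
  \<comment> \<open>The image partition is not known to arise by halvings, so it is refined to a
    grid, which does.\<close>
  obtain M where M: "finite {s. M s \<noteq> 0}" "\<forall>\<phi>\<in>\<psi> ` ?P. \<forall>s. length (\<phi> s) \<le> M s"
    using lpart_bound[OF Q] by blast
  let ?U = "labels_of M"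
  have "split\<^sup>*\<^sup>* (\<psi> ` ?P) ?U" by (rule splits_uniform[OF Q M(2,1)])
  then obtain R where R: "split\<^sup>*\<^sup>* ?P R" "matches G (finv h) ?U R"
    using matches_splits[OF _ Q _ G matches_inv[OF P h(1) G m]] h(1) by auto
  have sU: "split\<^sup>*\<^sup>* {lnil} ?U" by (rule splits_uniform[OF lpart_lnil]) (use M in simp_all)
  then have U: "lpart ?U" using splits_lpart lpart_lnil by blast
  have sR: "split\<^sup>*\<^sup>* {lnil} R" using sP R(1) by simp
  then have lR: "lpart R" using splits_lpart lpart_lnil by blast
  have "matches G h R ?U"
    using matches_inv[OF U _ G R(2)] h(1) by simp
  then obtain f \<gamma> where f: "f ` R = ?U" "\<And>\<phi>. \<phi> \<in> R \<Longrightarrow> \<gamma> \<phi> \<in> G \<and> realizes h \<phi> (\<gamma> \<phi>) (f \<phi>)"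
    by (auto simp: matches_def)
  have injf: "inj_on f R"
    by (rule realizes_inj_on[OF lR h(1), of \<gamma>]) (use f(2) perm_group_bij[OF G] in blast)
  obtain n m where n: "(split ^^ n) {lnil} R" "(split ^^ m) {lnil} ?U"
    using sR sU by (auto simp: rtranclp_power)
  \<comment> \<open>Each halving adds one brick, so equal sizes mean equal numbers of
    halvings.\<close>
  have "card R = card ?U" using injf f(1) card_image by metis
  then have "m = n" using splits_card[OF n(1) lpart_lnil] splits_card[OF n(2) lpart_lnil] by simp
  with n(2) have "(split ^^ n) {lnil} ?U" by simp
  from realize_splits[OF n(1) this]
  obtain g f' where g: "g \<in> \<Gamma>" "f' ` R = ?U" "\<And>\<phi>. \<phi> \<in> R \<Longrightarrow> realizes g \<phi> id (f' \<phi>)"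
    by auto
  have injf': "inj_on f' R"
    using realizes_inj_on[OF lR perm_group_bij[OF \<Gamma> g(1)], of "\<lambda>_. id"] g(3) bij_id by blast
  let ?k = "inv_into R f'"
  have k: "?k (f' \<phi>) = \<phi>" if "\<phi> \<in> R" for \<phi> using injf' that by simp
  have k': "bij_betw ?k ?U R" using injf' g(2) by (metis bij_betw_def bij_betw_inv_into)
  \<comment> \<open>The discrepancy between the matching \<open>f'\<close> given by \<open>g\<close>
    and the matching \<open>f\<close> given by \<open>h\<close>.\<close>
  let ?p = "\<lambda>\<psi>. if \<psi> \<in> ?U then f (?k \<psi>) else \<psi>"
  have "bij_betw (f \<circ> ?k) ?U ?U"
    using bij_betw_trans[OF k'] injf f(1) by (metis bij_betw_def)
  then have "bij_betw ?p ?U ?U" by (simp cong: bij_betw_cong)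
  then have "?p permutes ?U" by (rule bij_imp_permutes) simp
  then obtain g2 where g2: "g2 \<in> \<Gamma>" "\<And>\<psi>. \<psi> \<in> ?U \<Longrightarrow> realizes g2 \<psi> id (?p \<psi>)"
    using realize_permutation[OF U] by blast
  have "\<gamma> (?k \<psi>) \<in> G" if "\<psi> \<in> ?U" for \<psi>
    using f(2)[OF bij_betw_apply[OF k' that]] by blast
  then obtain g3 where g3: "g3 \<in> \<Gamma>" "\<And>\<psi>. \<psi> \<in> ?U \<Longrightarrow> realizes g3 \<psi> (\<gamma> (?k \<psi>)) \<psi>"
    using realize_twists[OF U, of "\<lambda>\<psi>. \<gamma> (?k \<psi>)"] by blast
  \<comment> \<open>Align by \<open>g\<close>, twist in place by \<open>g3\<close>, then permute by
    \<open>g2\<close>: this agrees with \<open>h\<close> on every brick of \<open>R\<close>.\<close>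
  have "realizes (g2 \<circ> (g3 \<circ> g)) \<phi> (\<gamma> \<phi>) (f \<phi>)" if \<phi>: "\<phi> \<in> R" for \<phi>
  proof -
    have \<phi>U: "f' \<phi> \<in> ?U" using g(2) \<phi> by blast
    have b: "bij (\<gamma> \<phi>)" using f(2)[OF \<phi>] perm_group_bij[OF G] by blast
    have "realizes g3 (f' \<phi>) (\<gamma> \<phi>) (f' \<phi>)" using g3(2)[OF \<phi>U] k[OF \<phi>] by simp
    from realizes_comp[OF g(3)[OF \<phi>] this bij_id b]
    have 1: "realizes (g3 \<circ> g) \<phi> (\<gamma> \<phi>) (f' \<phi>)" by simp
    have "realizes g2 (f' \<phi>) id (f \<phi>)" using g2(2)[OF \<phi>U] k[OF \<phi>] \<phi>U by simp
    from realizes_comp[OF 1 this b bij_id] show ?thesis by simp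
  qed
  then have "h = g2 \<circ> (g3 \<circ> g)"
    using realizes_ext_unique[OF lR] f(2) by blast
  then show "h \<in> \<Gamma>" using g(1) g2(1) g3(1) perm_group_comp[OF \<Gamma>] by simp
qed

end

section \<open>Finite generation\<close>

text \<open>Takes the letters of a label off from the front, one at a time and in some order of the
  coordinates; the induction that moves bricks consumes one letter per step.\<close>

primrec built :: "nat \<Rightarrow> ('s \<Rightarrow> bool list) \<Rightarrow> bool" where
  "built 0 \<alpha> \<longleftrightarrow> \<alpha> = lnil"
| "built (Suc n) \<alpha> \<longleftrightarrow> (\<exists>s a \<beta>. \<alpha> = lcat (single s [a]) \<beta> \<and> built n \<beta>)"

lemma built_lact: "built n \<alpha> \<Longrightarrow> bij \<gamma> \<Longrightarrow> built n (lact \<gamma> \<alpha>)"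
proof (induction n arbitrary: \<alpha>)
  case 0
  then show ?case by (simp add: lact_def)
next
  case (Suc n)
  then obtain s a \<beta> where "\<alpha> = lcat (single s [a]) \<beta>" "built n \<beta>" by auto
  then have "lact \<gamma> \<alpha> = lcat (single (\<gamma> s) [a]) (lact \<gamma> \<beta>)" "built n (lact \<gamma> \<beta>)"
    using Suc by (simp_all add: lact_lcat lact_single)
  then show ?case unfolding built.simps by blast
qed

lemma built_single: "built n \<beta> \<Longrightarrow> \<exists>m. built m (lcat (single s w) \<beta>)"
proof (induction w)
  case Nil
  have "single s [] = lnil" by (auto simp: single_def)
  then show ?case using Nil by auto
next
  case (Cons a w)
  then obtain m where "built m (lcat (single s w) \<beta>)" by blast
  then have "built (Suc m) (lcat (single s (a # w)) \<beta>)"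
    unfolding single_Cons[of s a w] lcat_assoc built.simps by blast
  then show ?case by blast
qed

text \<open>Induction on the finite support: the whole word at one coordinate is split off in
  front.\<close>

lemma brick_label_built:
  assumes "brick_label \<alpha>"
  shows "\<exists>n. built n \<alpha>"
proof -
  have "finite T \<Longrightarrow> {s. \<alpha> s \<noteq> []} \<subseteq> T \<Longrightarrow> \<exists>n. built n \<alpha>" for T \<alpha>
  proof (induction T arbitrary: \<alpha> rule: finite_induct)
    case empty
    then have "built 0 \<alpha>" by auto
    then show ?case by blast
  next
    case (insert s T)
    have "\<exists>n. built n (\<alpha>(s := []))"
      by (rule insert.IH) (use insert.prems in auto)
    moreover have "\<alpha> = lcat (single s (\<alpha> s)) (\<alpha>(s := []))"
      by (simp add: lcat_def single_def fun_eq_iff)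
    ultimately show ?case using built_single by metis
  qed
  then show ?thesis using assms unfolding brick_label_def by blast
qed

section \<open>Untwisted equivalence of bricks under a group\<close>

definition moves :: "(('s \<Rightarrow> cantor) \<Rightarrow> ('s \<Rightarrow> cantor)) set \<Rightarrow> ('s \<Rightarrow> bool list)
    \<Rightarrow> ('s \<Rightarrow> bool list) \<Rightarrow> bool" where
  "moves H \<phi> \<psi> \<longleftrightarrow> (\<exists>g\<in>H. realizes g \<phi> id \<psi>)"

lemma movesI: "g \<in> H \<Longrightarrow> realizes g \<phi> id \<psi> \<Longrightarrow> moves H \<phi> \<psi>"
  by (auto simp: moves_def)

lemma moves_trans:
  assumes "perm_group H" "moves H \<phi> \<psi>" "moves H \<psi> \<rho>"
  shows "moves H \<phi> \<rho>"
proof -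
  obtain g k where "g \<in> H" "realizes g \<phi> id \<psi>" "k \<in> H" "realizes k \<psi> id \<rho>"
    using assms(2,3) by (auto simp: moves_def)
  then show ?thesis
    using realizes_comp[of g \<phi> id \<psi> k id \<rho>] perm_group_comp[OF assms(1)]
    by (intro movesI[of "k \<circ> g"]) simp_all
qed

lemma moves_sym:
  assumes "perm_group H" "moves H \<phi> \<psi>"
  shows "moves H \<psi> \<phi>"
proof -
  obtain g where g: "g \<in> H" "realizes g \<phi> id \<psi>" using assms(2) by (auto simp: moves_def)
  then have "realizes (finv g) \<psi> id \<phi>"
    using realizes_inv[OF g(2) perm_group_bij[OF assms(1) g(1)] bij_id] by simp
  then show ?thesis using perm_group_inv[OF assms(1) g(1)] by (rule movesI[rotated])
qed

lemma moves_lcat: "moves H \<phi> \<psi> \<Longrightarrow> moves H (lcat \<phi> \<alpha>) (lcat \<psi> \<alpha>)"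
  unfolding moves_def using realizes_lcat[of _ \<phi> id \<psi> \<alpha>] by auto

text \<open>The two halves in direction \<open>s\<close> cover the space, so the action on both
  determines the map.\<close>

lemma bk_unique:
  assumes "\<And>a. realizes k (single s [a]) id (single t [a])"
  shows "k = bk s t"
proof
  fix \<kappa>
  have "\<kappa> \<in> brick (single s [\<kappa> s 0])" by (simp add: in_brick_single_iff)
  then obtain x where x: "\<kappa> = Phi (single s [\<kappa> s 0]) x" by (rule brickE)
  show "k \<kappa> = bk s t \<kappa>"
    using realizesD[OF assms, of "\<kappa> s 0" x] realizesD[OF realizes_bk, of s t "\<kappa> s 0" x] x by simp
qed

lemma finv_bk: "finv (bk s t) = bk t s"
  by (rule inv_unique_comp) (simp_all add: fun_eq_iff)

text \<open>\<open>loc \<phi>\<close> is a homomorphism, so the bijections whose copy lies in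
  \<open>H\<close> form a group. Whether copies lie in \<open>H\<close> can then be checked on
  generators.\<close>

lemma perm_group_loc_preimage:
  assumes "perm_group H"
  shows "perm_group {h. bij h \<and> loc \<phi> h \<in> H}"
  unfolding perm_group_def
  using perm_groupD[OF assms] by (auto simp: loc_comp bij_comp simp flip: finv_loc)

lemma apart_half:
  assumes "apart \<phi> (single r [True])"
  obtains \<beta> where "\<phi> = lcat (single r [False]) \<beta>"
proof
  \<comment> \<open>The padding with True is deliberate: were \<open>\<phi> r\<close> empty, this
    point would lie in the half excluded by the hypothesis.\<close>
  have "Phi \<phi> (\<lambda>_ _. True) r 0 = False"
    using apart_Phi[OF assms, of "\<lambda>_ _. True"] by (simp add: in_brick_single_iff)
  then have "\<phi> r \<noteq> []" "\<phi> r ! 0 = False" by (auto simp: Phi_def wcat_def split: if_splits)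
  then have "\<phi> r = False # tl (\<phi> r)" by (cases "\<phi> r") auto
  then show "\<phi> = lcat (single r [False]) (\<phi>(r := tl (\<phi> r)))"
    by (auto simp: lcat_def single_def fun_eq_iff)
qed

text \<open>A swap is the product of the swaps of corresponding pieces, whose supports are disjoint.
  This reduces a swap to pieces so small that a given element twists each of them.\<close>

lemma sw_subdivide:
  assumes H: "perm_group H" and P: "lpart P" and d: "apart \<phi> \<psi>"
    and sw: "\<And>\<alpha>. \<alpha> \<in> P \<Longrightarrow> sw (lcat \<phi> \<alpha>) (lcat \<psi> \<alpha>) \<in> H"
  shows "sw \<phi> \<psi> \<in> H"
proof -
  \<comment> \<open>The partial swap exchanging only the pieces in \<open>D\<close>; it grows from
    the identity to the full swap.\<close>
  define f where "f D \<kappa> = (if \<exists>\<alpha>\<in>D. \<kappa> \<in> brick (lcat \<phi> \<alpha>) \<union> brick (lcat \<psi> \<alpha>) then sw \<phi> \<psi> \<kappa> else \<kappa>)"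
    for D \<kappa>
  have d': "Phi \<phi> x \<notin> brick (lcat \<psi> \<beta>)" "Phi \<psi> x \<notin> brick (lcat \<phi> \<beta>)" for x \<beta>
    using apart_Phi[OF d] apart_Phi[OF apart_sym[OF d]] brick_lcat_subset by blast+
  have f1: "f D (Phi \<phi> x) = (if \<exists>\<alpha>\<in>D. x \<in> brick \<alpha> then Phi \<psi> x else Phi \<phi> x)"
    and f2: "f D (Phi \<psi> x) = (if \<exists>\<alpha>\<in>D. x \<in> brick \<alpha> then Phi \<phi> x else Phi \<psi> x)" for D x
    using d' by (simp_all add: f_def sw_Phi d)
  have f3: "f D \<kappa> = \<kappa>" if "\<kappa> \<notin> brick \<phi>" "\<kappa> \<notin> brick \<psi>" for D \<kappa>
    using that brick_lcat_subset[of \<phi>] brick_lcat_subset[of \<psi>] by (auto simp: f_def)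
  have s1: "sw (lcat \<phi> \<beta>) (lcat \<psi> \<beta>) (Phi \<phi> x) = (if x \<in> brick \<beta> then Phi \<psi> x else Phi \<phi> x)"
    and s2: "sw (lcat \<phi> \<beta>) (lcat \<psi> \<beta>) (Phi \<psi> x) = (if x \<in> brick \<beta> then Phi \<phi> x else Phi \<psi> x)" for \<beta> x
  proof -
    have *: "apart (lcat \<phi> \<beta>) (lcat \<psi> \<beta>)" by (rule apart_lcat[OF d])
    show "sw (lcat \<phi> \<beta>) (lcat \<psi> \<beta>) (Phi \<phi> x) = (if x \<in> brick \<beta> then Phi \<psi> x else Phi \<phi> x)"
      using sw_Phi(1)[of "lcat \<phi> \<beta>" "lcat \<psi> \<beta>"] d'
      by (auto simp: sw_outside Phi_Phi elim!: brickE)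
    show "sw (lcat \<phi> \<beta>) (lcat \<psi> \<beta>) (Phi \<psi> x) = (if x \<in> brick \<beta> then Phi \<phi> x else Phi \<psi> x)"
      using sw_Phi(2)[OF *] d'
      by (auto simp: sw_outside Phi_Phi elim!: brickE)
  qed
  have s3: "sw (lcat \<phi> \<beta>) (lcat \<psi> \<beta>) \<kappa> = \<kappa>" if "\<kappa> \<notin> brick \<phi>" "\<kappa> \<notin> brick \<psi>" for \<beta> \<kappa>
    using that brick_lcat_subset[of \<phi>] brick_lcat_subset[of \<psi>] by (auto intro!: sw_outside)
  have cases3: thesis if "\<And>x. \<kappa> = Phi \<phi> x \<Longrightarrow> thesis" "\<And>x. \<kappa> = Phi \<psi> x \<Longrightarrow> thesis"
    "\<kappa> \<notin> brick \<phi> \<Longrightarrow> \<kappa> \<notin> brick \<psi> \<Longrightarrow> thesis" for \<kappa> thesis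
    using that by (metis brickE)
  have "f D \<in> H" if "finite D" "D \<subseteq> P" for D
    using that
  proof (induction rule: finite_induct)
    case empty
    have "f {} = id" by (simp add: f_def fun_eq_iff)
    then show ?case using perm_group_id[OF H] by metis
  next
    case (insert \<beta> D)
    have ex: "x \<notin> brick \<beta>" if "\<alpha> \<in> D" "x \<in> brick \<alpha>" for \<alpha> x
      using lpart_unique[OF P, of \<alpha> \<beta> x] that insert by blast
    have "f (insert \<beta> D) \<kappa> = sw (lcat \<phi> \<beta>) (lcat \<psi> \<beta>) (f D \<kappa>)" for \<kappa>
      by (rule cases3[of \<kappa>]) (use ex in \<open>auto simp: f1 f2 f3 s1 s2 s3\<close>)
    then have "f (insert \<beta> D) = sw (lcat \<phi> \<beta>) (lcat \<psi> \<beta>) \<circ> f D" by (simp add: fun_eq_iff)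
    moreover have "sw (lcat \<phi> \<beta>) (lcat \<psi> \<beta>) \<circ> f D \<in> H"
      using insert sw perm_group_comp[OF H] by simp
    ultimately show ?case by metis
  qed
  then have "f P \<in> H" using lpart_finite[OF P] by blast
  moreover have "f P \<kappa> = sw \<phi> \<psi> \<kappa>" for \<kappa>
    by (rule cases3[of \<kappa>]) (use lpart_cover[OF P] in \<open>simp_all add: f1 f2 f3 sw_Phi d sw_outside\<close>)
  then have "f P = sw \<phi> \<psi>" by (simp add: fun_eq_iff)
  ultimately show ?thesis by simp
qed

section \<open>The finite generating set\<close>

locale sv_generators =
  fixes G A :: "('s \<Rightarrow> 's) set" and R :: "'s set" and r :: 's
  assumes G: "perm_group G" and A: "finite A" "A \<subseteq> G" "gen A = G"
    and R: "finite R" "\<And>s. \<exists>\<gamma>\<in>G. \<gamma> s \<in> R"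
begin

abbreviation h0 :: "'s \<Rightarrow> bool list" where "h0 \<equiv> single r [False]"
abbreviation h1 :: "'s \<Rightarrow> bool list" where "h1 \<equiv> single r [True]"

text \<open>The first swap exchanges the halves at \<open>r\<close>; the second identifies a quarter
  with a half and so absorbs letters; the third is the model to which swaps of small pieces are
  conjugated.\<close>

definition F0 :: "(('s \<Rightarrow> cantor) \<Rightarrow> ('s \<Rightarrow> cantor)) set" where
  "F0 = tau ` A \<union> (\<lambda>t. bk t r) ` R \<union>
     {sw h0 h1, sw h0 (lcat h1 h0), sw (lcat h1 h1) (lcat h0 h0)}"

text \<open>The copies permute coordinates and bake inside \<open>h0\<close> while keeping
  \<open>h0\<close> as a set. This suffices to move all proper bricks to \<open>h0\<close>.\<close>

definition F1 :: "(('s \<Rightarrow> cantor) \<Rightarrow> ('s \<Rightarrow> cantor)) set" where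
  "F1 = F0 \<union> loc h0 ` F0"

text \<open>The next level supplies copies of all of \<open>gen F1\<close> on \<open>h0\<close>, and
  by conjugation on every proper brick.\<close>

definition F2 :: "(('s \<Rightarrow> cantor) \<Rightarrow> ('s \<Rightarrow> cantor)) set" where
  "F2 = F1 \<union> loc h0 ` F1"

lemma apart_h: "apart h0 h1" "apart h1 h0"
  using apart_single[of r False] apart_single[of r True] by simp_all

lemma finite_F2: "finite F2"
  using A R by (simp add: F2_def F1_def F0_def)

lemma SV_loc: "h \<in> SV G \<Longrightarrow> brick_label \<phi> \<Longrightarrow> loc \<phi> h \<in> SV G"
  by (simp add: SV_iff[OF G] bij_loc locally_twist_loc[OF G])

lemma SV_sw: "brick_label \<phi> \<Longrightarrow> brick_label \<psi> \<Longrightarrow> apart \<phi> \<psi> \<Longrightarrow> sw \<phi> \<psi> \<in> SV G"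
  by (simp add: SV_iff[OF G] bij_sw locally_twist_sw[OF G])

lemma F0_SV: "F0 \<subseteq> SV G"
proof -
  have "tau \<gamma> \<in> SV G" if "\<gamma> \<in> A" for \<gamma>
    using that A(2) G by (auto simp: SV_iff locally_twist_tau bij_tau perm_group_bij)
  moreover have "bk t r \<in> SV G" for t
    by (simp add: SV_iff[OF G] bij_bk locally_twist_bk perm_group_id[OF G])
  moreover have "apart h0 (lcat h1 h0)" "apart (lcat h1 h1) (lcat h0 h0)"
    using apart_h apart_lcat apart_lcat_left apart_sym by blast+
  ultimately show ?thesis
    using apart_h by (auto simp: F0_def intro!: SV_sw)
qed

lemma F1_SV: "F1 \<subseteq> SV G"
  using F0_SV SV_loc by (auto simp: F1_def)

lemma F2_SV: "F2 \<subseteq> SV G"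
  using F1_SV SV_loc by (auto simp: F2_def)

lemma SV_bij: "SV G \<subseteq> Collect bij"
  by (auto simp: SV_iff[OF G])

lemma perm_group_F: "perm_group (gen F0)" "perm_group (gen F1)" "perm_group (gen F2)"
  using F0_SV F1_SV F2_SV SV_bij by (auto intro!: perm_group_gen)

lemma gen_F_mono: "gen F0 \<subseteq> gen F1" "gen F1 \<subseteq> gen F2"
  by (rule gen_subset[OF perm_group_F(2) subset_trans[OF _ subset_gen]], simp add: F1_def)
    (rule gen_subset[OF perm_group_F(3) subset_trans[OF _ subset_gen]], simp add: F2_def)

lemma loc_gen:
  assumes "perm_group H" "B \<subseteq> Collect bij" "loc \<phi> ` B \<subseteq> H" "h \<in> gen B"
  shows "loc \<phi> h \<in> H"
  using gen_subset[OF perm_group_loc_preimage[OF assms(1)], of B \<phi>] assms by auto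

lemma loc_F01: "h \<in> gen F0 \<Longrightarrow> loc h0 h \<in> gen F1"
  by (rule loc_gen[OF perm_group_F(2)]) (use F0_SV SV_bij subset_gen[of F1] in \<open>auto simp: F1_def\<close>)

lemma loc_F12: "h \<in> gen F1 \<Longrightarrow> loc h0 h \<in> gen F2"
  by (rule loc_gen[OF perm_group_F(3)]) (use F1_SV SV_bij subset_gen[of F2] in \<open>auto simp: F2_def\<close>)

text \<open>\<open>tau\<close> is a homomorphism, so the permutations it sends into
  \<open>gen F0\<close> form a group containing \<open>A\<close>, hence all of
  \<open>G\<close>.\<close>

lemma tau_F0:
  assumes "\<gamma> \<in> G"
  shows "tau \<gamma> \<in> gen F0"
proof -
  have "tau id = id" by (simp add: fun_eq_iff)
  then have "tau id \<in> gen F0" using perm_group_id[OF perm_group_F(1)] by metis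
  then have "perm_group {\<gamma>. bij \<gamma> \<and> tau \<gamma> \<in> gen F0}"
    using perm_groupD[OF perm_group_F(1)]
    by (auto simp: perm_group_def tau_comp bij_comp simp flip: inv_tau)
  moreover have "A \<subseteq> {\<gamma>. bij \<gamma> \<and> tau \<gamma> \<in> gen F0}"
    using A(2) perm_group_bij[OF G] subset_gen[of F0] by (auto simp: F0_def)
  ultimately show ?thesis using gen_subset A(3) assms by blast
qed

section \<open>Moving proper bricks to the half cube\<close>

lemma moves_r:
  assumes "t \<in> R"
  shows "moves (gen F0) (single t [a]) h0"
proof -
  have "bk t r \<in> gen F0" using assms subset_gen[of F0] by (auto simp: F0_def)
  then have 1: "moves (gen F0) (single t [a]) (single r [a])"
    using realizes_bk by (rule movesI)
  \<comment> \<open>Exchanging the halves normalises the letter at \<open>r\<close> to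
    False.\<close>
  have "sw h0 h1 \<in> gen F0" using subset_gen[of F0] by (auto simp: F0_def)
  then have "moves (gen F0) h1 h0" using realizes_sw2 apart_h(1) by (intro movesI)
  with 1 show ?thesis using moves_trans[OF perm_group_F(1)] by (cases a) auto
qed

text \<open>Absorption of a letter: exchanging the halves turns the front letter into True, and the
  second swap of \<open>F0\<close> carries this quarter to \<open>h0\<close>.\<close>

lemma moves_shrink: "moves (gen F0) (lcat h0 h0) h0"
proof -
  have s: "sw h0 h1 \<in> gen F0" "sw h0 (lcat h1 h0) \<in> gen F0"
    using subset_gen[of F0] by (auto simp: F0_def)
  have "moves (gen F0) (lcat h0 h0) (lcat h1 h0)"
    using movesI[OF s(1) realizes_sw1] by (rule moves_lcat)
  moreover have "moves (gen F0) (lcat h1 h0) h0"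
    by (rule movesI[OF s(2) realizes_sw2[OF apart_sym[OF apart_lcat_left[OF apart_h(2)]]]])
  ultimately show ?thesis by (rule moves_trans[OF perm_group_F(1)])
qed

lemma moves_loc: "moves (gen F0) \<phi> \<psi> \<Longrightarrow> moves (gen F1) (lcat h0 \<phi>) (lcat h0 \<psi>)"
  unfolding moves_def using realizes_loc loc_F01 by blast

lemma moves_mono: "moves (gen F0) \<phi> \<psi> \<Longrightarrow> moves (gen F1) \<phi> \<psi>"
  unfolding moves_def using gen_F_mono by blast

text \<open>A twist by \<open>\<gamma>\<close> on the way to \<^term>\<open>h0\<close> is undone by the local twist on \<^term>\<open>h0\<close>.\<close>
lemma moves_untwist:
  assumes "g \<in> gen F1" "\<gamma> \<in> G" "realizes g \<phi> \<gamma> \<psi>" "moves (gen F1) \<psi> h0"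
  shows "moves (gen F1) \<phi> h0"
proof -
  obtain k where k: "k \<in> gen F1" "realizes k \<psi> id h0" using assms(4) by (auto simp: moves_def)
  let ?l = "loc h0 (tau (finv \<gamma>))"
  have b: "bij \<gamma>" using assms(2) perm_group_bij[OF G] by blast
  have "realizes (k \<circ> g) \<phi> \<gamma> h0" using realizes_comp[OF assms(3) k(2) b bij_id] by simp
  from realizes_comp[OF this realizes_loc_tau[of h0 "finv \<gamma>"] b]
  have "realizes (?l \<circ> (k \<circ> g)) \<phi> id h0" using b by (simp add: bij_finv_comp)
  moreover have "?l \<circ> (k \<circ> g) \<in> gen F1"
    using assms(1) k(1) loc_F01[OF tau_F0] perm_group_inv[OF G assms(2)]
      perm_group_comp[OF perm_group_F(2)] by blast
  ultimately show ?thesis by (rule movesI[rotated])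
qed

text \<open>Inside \<open>h0\<close> a permutation brings the next letter to a coordinate in
  \<open>R\<close> and a baker map brings it to \<open>r\<close>, where it is absorbed. The
  remaining letters are permuted on the way, but their number stays the same, so the induction
  applies.\<close>

lemma moves_below_h0: "built n \<alpha> \<Longrightarrow> moves (gen F1) (lcat h0 \<alpha>) h0"
proof (induction n arbitrary: \<alpha>)
  case 0
  then show ?case
    using perm_group_id[OF perm_group_F(2)] realizes_id by (auto intro!: movesI[of id])
next
  case (Suc n)
  then obtain s a \<beta> where \<alpha>: "\<alpha> = lcat (single s [a]) \<beta>" "built n \<beta>" by auto
  obtain \<gamma> where \<gamma>: "\<gamma> \<in> G" "\<gamma> s \<in> R" using R(2) by blast
  then have b: "bij \<gamma>" using perm_group_bij[OF G] by blast
  let ?\<beta> = "lact \<gamma> \<beta>"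
  have "lact \<gamma> \<alpha> = lcat (single (\<gamma> s) [a]) ?\<beta>" using \<alpha>(1) b by (simp add: lact_lcat lact_single)
  then have tw: "realizes (loc h0 (tau \<gamma>)) (lcat h0 \<alpha>) \<gamma> (lcat (lcat h0 (single (\<gamma> s) [a])) ?\<beta>)"
    using realizes_loc[OF realizes_tau, of h0 \<gamma> \<alpha>] by (simp add: lcat_assoc)
  have "moves (gen F1) (lcat h0 (single (\<gamma> s) [a])) (lcat h0 h0)"
    by (rule moves_loc[OF moves_r[OF \<gamma>(2)]])
  also note moves_mono[OF moves_shrink]
  finally (moves_trans[OF perm_group_F(2)])
  have "moves (gen F1) (lcat (lcat h0 (single (\<gamma> s) [a])) ?\<beta>) (lcat h0 ?\<beta>)"
    by (rule moves_lcat)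
  moreover have "moves (gen F1) (lcat h0 ?\<beta>) h0"
    using Suc.IH built_lact[OF \<alpha>(2) b] by blast
  ultimately have "moves (gen F1) (lcat (lcat h0 (single (\<gamma> s) [a])) ?\<beta>) h0"
    by (rule moves_trans[OF perm_group_F(2)])
  then show ?case
    using moves_untwist[OF loc_F01[OF tau_F0[OF \<gamma>(1)]] \<gamma>(1) tw] by blast
qed

text \<open>Global elements turn the first letter into \<open>h0\<close>; the remaining letters are
  treated inside \<open>h0\<close>. The whole space is excluded since a bijection maps it to
  itself.\<close>

lemma moves_h0:
  assumes "brick_label \<phi>" "\<phi> \<noteq> lnil"
  shows "moves (gen F1) \<phi> h0"
proof -
  obtain n where n: "built n \<phi>" using brick_label_built[OF assms(1)] by blast
  with assms(2) obtain m where "n = Suc m" by (cases n) auto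
  with n obtain s a \<beta> where \<alpha>: "\<phi> = lcat (single s [a]) \<beta>" "built m \<beta>" by auto
  obtain \<gamma> where \<gamma>: "\<gamma> \<in> G" "\<gamma> s \<in> R" using R(2) by blast
  then have b: "bij \<gamma>" using perm_group_bij[OF G] by blast
  let ?\<beta> = "lact \<gamma> \<beta>"
  have tw: "realizes (tau \<gamma>) \<phi> \<gamma> (lcat (single (\<gamma> s) [a]) ?\<beta>)"
    using realizes_tau[of \<gamma> \<phi>] \<alpha>(1) b by (simp add: lact_lcat lact_single)
  have "moves (gen F1) (lcat (single (\<gamma> s) [a]) ?\<beta>) (lcat h0 ?\<beta>)"
    by (rule moves_lcat[OF moves_mono[OF moves_r[OF \<gamma>(2)]]])
  moreover have "moves (gen F1) (lcat h0 ?\<beta>) h0"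
    using moves_below_h0 built_lact[OF \<alpha>(2) b] by blast
  ultimately have "moves (gen F1) (lcat (single (\<gamma> s) [a]) ?\<beta>) h0"
    by (rule moves_trans[OF perm_group_F(2)])
  moreover have "tau \<gamma> \<in> gen F1" using tau_F0[OF \<gamma>(1)] gen_F_mono by blast
  ultimately show ?thesis using moves_untwist[OF _ \<gamma>(1) tw] by blast
qed

section \<open>Copies, baker maps and swaps on arbitrary bricks\<close>

lemma single_neq_lnil: "single s [a] \<noteq> lnil"
  by (auto simp: single_def fun_eq_iff)

lemma ext_neq_lnil: "ext \<phi> s a \<noteq> lnil"
  by (auto simp: lcat_def single_def fun_eq_iff intro!: exI[of _ s])

lemma moves_h0_h1: "moves (gen F1) h0 h1"
  by (rule moves_sym[OF perm_group_F(2) moves_h0[OF brick_label_single single_neq_lnil]])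

text \<open>Some element of \<open>gen F1\<close> carries \<open>h0\<close> canonically to \<phi>;
  conjugation by it carries the copy along.\<close>

lemma loc_transport:
  assumes "perm_group H" "gen F1 \<subseteq> H" "loc h0 h \<in> H" "brick_label \<phi>" "\<phi> \<noteq> lnil"
  shows "loc \<phi> h \<in> H"
proof -
  obtain g where g: "g \<in> gen F1" "realizes g h0 id \<phi>"
    using moves_sym[OF perm_group_F(2) moves_h0[OF assms(4,5)]] by (auto simp: moves_def)
  then show ?thesis
    using loc_conj[OF perm_group_bij[OF perm_group_F(2) g(1)] g(2), of h] assms
      perm_group_comp[OF assms(1)] perm_group_inv[OF assms(1)] by auto
qed

lemma loc_tau_F1:
  assumes "brick_label \<phi>" "\<phi> \<noteq> lnil" "\<gamma> \<in> G"
  shows "loc \<phi> (tau \<gamma>) \<in> gen F1"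
  using loc_transport[OF perm_group_F(2) _ loc_F01[OF tau_F0[OF assms(3)]]] assms by blast

text \<open>Among the generators, global baker maps start in \<open>R\<close> and end in
  \<open>r\<close>. For general \<open>s\<close> a permutation first brings \<open>s\<close> into
  \<open>R\<close>, and local permutations on both halves undo its twist before baking. Arbitrary
  coordinates are then joined through \<open>r\<close>.\<close>

lemma bk_F1: "bk s t \<in> gen F1"
proof -
  have "bk s r \<in> gen F1" for s
  proof -
    obtain \<gamma> where \<gamma>: "\<gamma> \<in> G" "\<gamma> s \<in> R" using R(2) by blast
    then have b: "bij \<gamma>" using perm_group_bij[OF G] by blast
    let ?t = "\<gamma> s"
    let ?l = "\<lambda>a. loc (single ?t [a]) (tau (finv \<gamma>))"
    have l: "?l a \<in> gen F1" for a
      by (rule loc_tau_F1[OF brick_label_single single_neq_lnil perm_group_inv[OF G \<gamma>(1)]])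
    have disj: "apart (single ?t [True]) (single ?t [False])" "apart (single ?t [False]) (single ?t [True])"
      using apart_single[of ?t True] apart_single[of ?t False] by simp_all
    have l2: "realizes (?l True \<circ> ?l False) (single ?t [a]) (finv \<gamma>) (single ?t [a])" for a
    proof (cases a)
      case True
      from realizes_comp[OF realizes_loc_apart[OF disj(2)] realizes_loc_tau bij_id] show ?thesis
        using True b by simp
    next
      case False
      from realizes_comp[OF realizes_loc_tau realizes_loc_apart[OF disj(1)] _ bij_id] show ?thesis
        using False b by simp
    qed
    have "realizes (tau \<gamma>) (single s [a]) \<gamma> (single ?t [a])" for a
      using realizes_tau[of \<gamma> "single s [a]"] b by (simp add: lact_single)
    from realizes_comp[OF this l2 b]
    have "realizes (?l True \<circ> ?l False \<circ> tau \<gamma>) (single s [a]) id (single ?t [a])" for a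
      using b by (simp add: bij_finv_comp)
    from realizes_comp[OF this realizes_bk bij_id bij_id]
    have "bk ?t r \<circ> (?l True \<circ> ?l False \<circ> tau \<gamma>) = bk s r"
      by (intro bk_unique) simp
    moreover have "bk ?t r \<in> gen F1" "tau \<gamma> \<in> gen F1"
      using \<gamma> tau_F0 subset_gen[of F0] gen_F_mono by (auto simp: F0_def)
    ultimately show ?thesis using l perm_group_comp[OF perm_group_F(2)] by metis
  qed
  note * = this
  have "realizes (bk r t \<circ> bk s r) (single s [a]) id (single t [a])" for a
    using realizes_comp[OF realizes_bk[of s r a] realizes_bk[of r t a] bij_id bij_id] by simp
  then have "bk s t = bk r t \<circ> bk s r" by (rule bk_unique[symmetric])
  then show ?thesis
    using *[of s] *[of t] perm_group_comp[OF perm_group_F(2)] perm_group_inv[OF perm_group_F(2)]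
    by (metis finv_bk)
qed

text \<open>The whole space cannot be moved to \<open>h0\<close>, but there the copy is the element
  itself.\<close>

lemma loc_F2:
  assumes "brick_label \<phi>" "h \<in> gen F1"
  shows "loc \<phi> h \<in> gen F2"
proof (cases "\<phi> = lnil")
  case True
  then show ?thesis using assms gen_F_mono by auto
next
  case False
  then show ?thesis
    using loc_transport[OF perm_group_F(3) gen_F_mono(2) loc_F12[OF assms(2)] assms(1)] by blast
qed

text \<open>An element moving \<open>\<phi>\<close> to \<^term>\<open>h1\<close> twists sufficiently small pieces of \<open>\<psi>\<close> into \<^term>\<open>h0\<close>.
  Local copies on \<^term>\<open>h0\<close> and \<^term>\<open>h1\<close> then move the two pieces independently.\<close>
lemma sw_F2:
  assumes \<phi>: "brick_label \<phi>" and \<psi>: "brick_label \<psi>" and d: "apart \<phi> \<psi>"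
  shows "sw \<phi> \<psi> \<in> gen F2"
proof -
  have "\<phi> \<noteq> lnil" using apart_Phi[OF apart_sym[OF d]] by auto
  from moves_trans[OF perm_group_F(2) moves_h0[OF \<phi> this] moves_h0_h1]
  have "moves (gen F1) \<phi> h1" .
  then obtain g where g: "g \<in> gen F1" "realizes g \<phi> id h1" by (auto simp: moves_def)
  have bg: "bij g" using g(1) perm_group_bij[OF perm_group_F(2)] by blast
  have "gen F1 \<subseteq> SV G" by (rule gen_subset[OF perm_group_SV[OF G] F1_SV])
  then have "locally_twist G g" using g(1) SV_iff[OF G] by blast
  then obtain L where L: "finite {s. L s \<noteq> 0}"
    and tw: "\<And>\<rho>. \<rho> \<in> labels_of L \<Longrightarrow> \<exists>\<psi> \<gamma>. brick_label \<psi> \<and> \<gamma> \<in> G \<and> realizes g \<rho> \<gamma> \<psi>"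
    using locally_twist_uniform[OF _ G] by metis
  have P: "lpart (labels_of L)"
    using splits_uniform[OF lpart_lnil, of L] L splits_lpart lpart_lnil by auto
  \<comment> \<open>The extra letter at \<open>r\<close> keeps the labels \<open>?\<alpha>\<close>
    and \<open>?\<delta>\<close> different from \<open>lnil\<close>, so that \<open>moves_h0\<close>
    applies to both.\<close>
  have piece: "sw (ext (lcat \<phi> \<alpha>) r a) (ext (lcat \<psi> \<alpha>) r a) \<in> gen F2" if \<alpha>: "\<alpha> \<in> labels_of L" for \<alpha> a
  proof -
    let ?\<alpha> = "ext \<alpha> r a"
    have lab: "brick_label \<alpha>" using lpart_label[OF P \<alpha>] .
    obtain \<kappa> where \<kappa>: "\<kappa> \<in> brick (lcat \<psi> \<alpha>)" using Phi_in_brick by blast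
    have "lcat \<psi> \<alpha> \<in> labels_of (\<lambda>s. length (lcat \<psi> \<alpha> s))" by (simp add: labels_of_def)
    then have "lcat \<psi> \<alpha> = pre \<kappa> (\<lambda>s. length (lcat \<psi> \<alpha> s))"
      using \<kappa> by (rule labels_of_eq_pre)
    \<comment> \<open>Already \<alpha> supplies length \<open>L s\<close> at each \<open>s\<close>,
      so this piece of \<psi> lies in one grid cell, on which \<open>g\<close> is a twist.\<close>
    moreover have "length (pre \<kappa> L s) \<le> length (lcat \<psi> \<alpha> s)" for s
      using \<alpha> by (simp add: pre_def labels_of_def lcat_def)
    ultimately obtain \<beta> where \<beta>: "lcat \<psi> \<alpha> = lcat (pre \<kappa> L) \<beta>"
      using pre_eq_lcat[of \<kappa> "pre \<kappa> L" "\<lambda>s. length (lcat \<psi> \<alpha> s)"] by auto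
    obtain \<rho> \<gamma> where \<rho>: "brick_label \<rho>" "\<gamma> \<in> G" "realizes g (pre \<kappa> L) \<gamma> \<rho>"
      using tw[OF pre_labels_of] by blast
    have b: "bij \<gamma>" using \<rho>(2) perm_group_bij[OF G] by blast
    let ?\<rho> = "lcat \<rho> (lact \<gamma> \<beta>)"
    have r1: "realizes g (lcat \<psi> \<alpha>) \<gamma> ?\<rho>" using realizes_lcat[OF \<rho>(3)] \<beta> by simp
    \<comment> \<open>As \<open>g\<close> maps \<phi> onto \<open>h1\<close>, the image of the
      disjoint piece of \<psi> lies in the other half \<open>h0\<close>.\<close>
    have "apart (lcat \<psi> \<alpha>) \<phi>" using d apart_sym apart_lcat_left by blast
    then have "apart ?\<rho> h1" using apart_realizes[OF _ r1 g(2) bg b bij_id] by blast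
    then obtain \<delta> where \<delta>: "?\<rho> = lcat h0 \<delta>" by (rule apart_half)
    have "brick_label (lcat \<psi> \<alpha>)" using \<psi> lab by simp
    then have "brick_label \<beta>" unfolding \<beta> by simp
    then have "brick_label ?\<rho>" using \<rho>(1) b by simp
    then have lab\<delta>: "brick_label \<delta>" unfolding \<delta> by simp
    let ?\<delta> = "ext \<delta> (\<gamma> r) a"
    have r2: "realizes g (ext (lcat \<psi> \<alpha>) r a) \<gamma> (lcat h0 ?\<delta>)"
      using realizes_ext[OF r1 b, of r a] unfolding \<delta> by (simp add: lcat_assoc)
    have r3: "realizes g (ext (lcat \<phi> \<alpha>) r a) id (lcat h1 ?\<alpha>)"
      using realizes_lcat[OF g(2), of ?\<alpha>] by (simp add: lcat_assoc)
    \<comment> \<open>Undoes the twist on the image of the piece of \<psi> and fixes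
      \<open>h1\<close> pointwise.\<close>
    let ?l = "loc (lcat h0 ?\<delta>) (tau (finv \<gamma>))"
    have l: "?l \<in> gen F2"
      using loc_F2[of "lcat h0 ?\<delta>"] tau_F0[OF perm_group_inv[OF G \<rho>(2)]] gen_F_mono lab\<delta> by auto
    obtain k0 where k0: "k0 \<in> gen F1" "realizes k0 ?\<delta> id h0"
      using moves_h0[OF _ ext_neq_lnil] lab\<delta> unfolding moves_def by (metis brick_label_lcat brick_label_single)
    have "moves (gen F1) ?\<alpha> h1"
      by (rule moves_trans[OF perm_group_F(2) moves_h0[OF _ ext_neq_lnil] moves_h0_h1])
        (simp add: lab)
    then obtain k1 where k1: "k1 \<in> gen F1" "realizes k1 ?\<alpha> id h1" by (auto simp: moves_def)
    \<comment> \<open>This carries the pieces of \<phi> and \<psi> canonically to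
      \<open>lcat h1 h1\<close> and \<open>lcat h0 h0\<close>, the bricks exchanged by the third
      swap in \<open>F0\<close>.\<close>
    let ?k = "loc h1 k1 \<circ> (loc h0 k0 \<circ> (?l \<circ> g))"
    note comp = perm_group_comp[OF perm_group_F(3)]
    have "?l \<circ> g \<in> gen F2" using comp[OF l] g(1) gen_F_mono(2) by blast
    then have k: "?k \<in> gen F2"
      by (rule comp[OF loc_F2[OF brick_label_single k1(1)] comp[OF loc_F2[OF brick_label_single k0(1)]]])
    have "realizes (?l \<circ> g) (ext (lcat \<psi> \<alpha>) r a) id (lcat h0 ?\<delta>)"
      using realizes_comp[OF r2 realizes_loc_tau b, of "finv \<gamma>"] b by (simp add: bij_finv_comp)
    from realizes_comp[OF realizes_comp[OF this realizes_loc[OF k0(2)] bij_id bij_id]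
        realizes_loc_apart[OF apart_sym[OF apart_lcat_left[OF apart_h(1)]]] _ bij_id]
    have e2: "realizes ?k (ext (lcat \<psi> \<alpha>) r a) id (lcat h0 h0)" by simp
    have "realizes (?l \<circ> g) (ext (lcat \<phi> \<alpha>) r a) id (lcat h1 ?\<alpha>)"
      using realizes_comp[OF r3 realizes_loc_apart[OF apart_lcat[OF apart_h(1)]] bij_id bij_id] by simp
    from realizes_comp[OF realizes_comp[OF this
          realizes_loc_apart[OF apart_sym[OF apart_lcat_left[OF apart_h(2)]]] bij_id bij_id]
        realizes_loc[OF k1(2)] _ bij_id]
    have e1: "realizes ?k (ext (lcat \<phi> \<alpha>) r a) id (lcat h1 h1)" by simp
    have "apart (ext (lcat \<phi> \<alpha>) r a) (ext (lcat \<psi> \<alpha>) r a)" using d apart_lcat by blast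
    from sw_conj[OF perm_group_bij[OF perm_group_F(3) k] e1 e2 this]
    show ?thesis
      using k subset_gen[of F2] perm_group_comp[OF perm_group_F(3)] perm_group_inv[OF perm_group_F(3)]
      by (auto simp: F2_def F1_def F0_def)
  qed
  \<comment> \<open>The pieces are assembled in two stages: first the halves at \<open>r\<close>,
    then the grid cells.\<close>
  have half: "lpart {single r [False], single r [True]}"
    using split_at_lpart(1)[OF lpart_lnil, of lnil r] by (simp add: split_at_def)
  have "sw (lcat \<phi> \<alpha>) (lcat \<psi> \<alpha>) \<in> gen F2" if "\<alpha> \<in> labels_of L" for \<alpha>
    by (rule sw_subdivide[OF perm_group_F(3) half apart_lcat[OF d]]) (use piece[OF that] in auto)
  then show ?thesis by (rule sw_subdivide[OF perm_group_F(3) P d])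
qed

lemma fin_gen_SV: "fin_gen_perm (SV G)"
proof -
  interpret swap_closed "gen F2" G
    by unfold_locales
      (use perm_group_F G loc_F2 bk_F1 sw_F2 tau_F0 gen_F_mono in blast)+
  have "gen F2 = SV G"
    using SV_subset gen_subset[OF perm_group_SV[OF G] F2_SV] by blast
  then show ?thesis
    unfolding fin_gen_perm_def using finite_F2 F2_SV by blast
qed

end

section \<open>Necessity\<close>

text \<open>The twist puts the first bit of \<open>x\<close> at \<open>finv \<delta> s\<close> right
  behind the range label at \<open>s\<close>, while \<open>tau \<gamma>\<close> fills coordinate
  \<open>s\<close> from \<open>finv \<gamma> s\<close> alone. The two sources must therefore
  coincide, and any brick reveals the permutation.\<close>

lemma realizes_unique_twist:
  assumes h: "realizes (tau \<gamma>) \<phi> \<delta> \<psi>" and b: "bij \<gamma>" "bij \<delta>"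
  shows "\<gamma> = \<delta>"
proof -
  have "finv \<gamma> s = finv \<delta> s" for s
  proof (rule ccontr)
    assume ne: "finv \<gamma> s \<noteq> finv \<delta> s"
    let ?n = "length (\<psi> s)"
    \<comment> \<open>These points differ only at \<open>finv \<delta> s\<close>, which does not
      affect coordinate \<open>finv \<gamma> s\<close>.\<close>
    define x y :: "'a \<Rightarrow> cantor" where "x = (\<lambda>_ _. False)" and "y = (\<lambda>t _. t = finv \<delta> s)"
    have eq: "Phi \<phi> z (finv \<gamma> s) ?n = z (finv \<delta> s) 0" for z
    proof -
      have "tau \<gamma> (Phi \<phi> z) s ?n = Phi \<psi> (tau \<delta> z) s ?n" using realizesD[OF h] by simp
      then show ?thesis by (simp add: tau_def) (simp add: Phi_def wcat_def)
    qed
    have "Phi \<phi> x (finv \<gamma> s) = Phi \<phi> y (finv \<gamma> s)"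
      using ne by (simp add: Phi_def x_def y_def)
    then show False using eq[of x] eq[of y] by (simp add: x_def y_def)
  qed
  then have "finv \<gamma> = finv \<delta>" by blast
  then show ?thesis using b by (metis bij_finv(4))
qed

lemma tau_SV_iff:
  assumes "perm_group G" "bij \<gamma>"
  shows "tau \<gamma> \<in> SV G \<longleftrightarrow> \<gamma> \<in> G"
proof
  assume "tau \<gamma> \<in> SV G"
  then have "locally_twist G (tau \<gamma>)" by (simp add: SV_iff[OF assms(1)])
  then obtain \<phi> \<psi> \<delta> x where "\<delta> \<in> G" "realizes (tau \<gamma>) \<phi> \<delta> \<psi>" by (rule locally_twistE)
  then show "\<gamma> \<in> G"
    using realizes_unique_twist assms perm_group_bij by metis
qed (use assms in \<open>simp add: SV_iff locally_twist_tau bij_tau\<close>)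

text \<open>Packing the indexed data into a finite set of triples allows one choice for all
  generators at once.\<close>

lemma SV_data:
  assumes "perm_group G" "h \<in> SV G"
  shows "\<exists>D. finite D \<and>
      (\<forall>(\<phi>, \<psi>, \<gamma>)\<in>D. brick_label \<phi> \<and> brick_label \<psi> \<and> \<gamma> \<in> G \<and> realizes h \<phi> \<gamma> \<psi>) \<and>
      (\<forall>\<kappa>. \<exists>(\<phi>, \<psi>, \<gamma>)\<in>D. \<kappa> \<in> brick \<phi>)"
proof -
  from assms(2) obtain n \<phi> \<psi> \<gamma> where p: "brick_partition n \<phi>" "brick_partition n \<psi>"
    and 1: "\<forall>i<n. \<gamma> i \<in> G" "\<forall>i<n. realizes h (\<phi> i) (\<gamma> i) (\<psi> i)"
    by (auto simp: SV_def realizes_twist)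
  have cover: "(\<Union>i<n. brick (\<phi> i)) = UNIV" using p(1) by (simp add: brick_partition_def)
  show ?thesis
  proof (intro exI[of _ "(\<lambda>i. (\<phi> i, \<psi> i, \<gamma> i)) ` {..<n}"] conjI)
    show "\<forall>\<kappa>. \<exists>(\<phi>, \<psi>, \<gamma>)\<in>(\<lambda>i. (\<phi> i, \<psi> i, \<gamma> i)) ` {..<n}. \<kappa> \<in> brick \<phi>"
      using cover by (simp add: set_eq_iff)
  qed (use p 1 in \<open>auto simp: brick_partition_def\<close>)
qed

lemma fin_gen_SV_necessary:
  fixes G :: "('s \<Rightarrow> 's) set"
  assumes G: "perm_group G" and fg: "fin_gen_perm (SV G)"
  shows "fin_gen_perm G \<and> finite (orbits G)"
proof -
  obtain F where F: "finite F" "F \<subseteq> SV G" "gen F = SV G"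
    using fg by (auto simp: fin_gen_perm_def)
  have "\<forall>h\<in>F. \<exists>D. finite D \<and>
      (\<forall>(\<phi>, \<psi>, \<gamma>)\<in>D. brick_label \<phi> \<and> brick_label \<psi> \<and> \<gamma> \<in> G \<and> realizes h \<phi> \<gamma> \<psi>) \<and>
      (\<forall>\<kappa>. \<exists>(\<phi>, \<psi>, \<gamma>)\<in>D. \<kappa> \<in> brick \<phi>)"
  proof
    fix h assume "h \<in> F"
    then have "h \<in> SV G" using F(2) by blast
    then show "\<exists>D. finite D \<and>
      (\<forall>(\<phi>, \<psi>, \<gamma>)\<in>D. brick_label \<phi> \<and> brick_label \<psi> \<and> \<gamma> \<in> G \<and> realizes h \<phi> \<gamma> \<psi>) \<and>
      (\<forall>\<kappa>. \<exists>(\<phi>, \<psi>, \<gamma>)\<in>D. \<kappa> \<in> brick \<phi>)"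
      by (rule SV_data[OF G])
  qed
  then obtain D where D: "\<forall>h\<in>F. finite (D h) \<and>
      (\<forall>(\<phi>, \<psi>, \<gamma>)\<in>D h. brick_label \<phi> \<and> brick_label \<psi> \<and> \<gamma> \<in> G \<and> realizes h \<phi> \<gamma> \<psi>) \<and>
      (\<forall>\<kappa>. \<exists>(\<phi>, \<psi>, \<gamma>)\<in>D h. \<kappa> \<in> brick \<phi>)"
    by (rule bchoice[THEN exE])
  have D1: "finite (D h)" if "h \<in> F" for h using D that by blast
  have D2: "brick_label \<phi> \<and> brick_label \<psi> \<and> \<gamma> \<in> G \<and> realizes h \<phi> \<gamma> \<psi>"
    if "h \<in> F" "(\<phi>, \<psi>, \<gamma>) \<in> D h" for h \<phi> \<psi> \<gamma>
    using D that by fast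
  have D3: "\<exists>\<phi> \<psi> \<gamma>. (\<phi>, \<psi>, \<gamma>) \<in> D h \<and> \<kappa> \<in> brick \<phi>" if "h \<in> F" for h \<kappa>
    using D that by fast
  \<comment> \<open>\<open>A\<close> will generate \<open>G\<close>, and \<open>T\<close> will meet
    every orbit.\<close>
  define A where "A = (\<Union>h\<in>F. (\<lambda>(\<phi>, \<psi>, \<gamma>). \<gamma>) ` D h)"
  define T where "T = (\<Union>h\<in>F. \<Union>(\<phi>, \<psi>, \<gamma>)\<in>D h. {s. \<phi> s \<noteq> []} \<union> {s. \<psi> s \<noteq> []})"
  have A: "finite A" "A \<subseteq> G" using F(1) D1 D2 by (auto simp: A_def)
  have T: "finite T" using F(1) D1 D2 by (force simp: T_def brick_label_def)
  have bF: "bij h" if "h \<in> F" for h using that F(2) SV_iff[OF G] by blast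

  have G': "perm_group (gen A)"
    using A(2) perm_group_bij[OF G] by (intro perm_group_gen) blast
  have "locally_twist (gen A) h" if h: "h \<in> F" for h
  proof (rule locally_twistI)
    fix \<kappa>
    obtain \<phi> \<psi> \<gamma> where *: "(\<phi>, \<psi>, \<gamma>) \<in> D h" "\<kappa> \<in> brick \<phi>" using D3[OF h] by blast
    then have "\<gamma> \<in> A" using h by (force simp: A_def)
    then show "\<exists>\<phi> \<psi> \<gamma>. brick_label \<phi> \<and> brick_label \<psi> \<and> \<gamma> \<in> gen A \<and> \<kappa> \<in> brick \<phi> \<and> realizes h \<phi> \<gamma> \<psi>"
      using D2[OF h *(1)] *(2) subset_gen[of A] by blast
  qed
  then have "F \<subseteq> SV (gen A)" using bF by (auto simp: SV_iff[OF G'])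
  then have SV': "SV G \<subseteq> SV (gen A)"
    using gen_subset[OF perm_group_SV[OF G']] F(3) by blast
  \<comment> \<open>Each \<open>tau \<gamma>\<close> with \<gamma> in \<open>G\<close> lies in
    \<open>SV (gen A)\<close>, and its permutation is determined on any brick.\<close>
  have "G \<subseteq> gen A"
    using SV' tau_SV_iff[OF G] tau_SV_iff[OF G'] perm_group_bij[OF G] by blast
  then have "gen A = G" using gen_subset[OF G A(2)] by blast
  then have 1: "fin_gen_perm G" using A by (auto simp: fin_gen_perm_def)

  have "orbits G \<subseteq> (\<lambda>t. {g t | g. g \<in> G}) ` T"
  proof
    fix O' assume "O' \<in> orbits G"
    then obtain s where s: "O' = {g s | g. g \<in> G}" by (auto simp: orbits_def)
    have inO: "g u \<in> O'" if gu: "g \<in> G" "u \<in> O'" for g u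
    proof -
      obtain k where "k \<in> G" "u = k s" using gu(2) s by blast
      then have "g \<circ> k \<in> G" "g u = (g \<circ> k) s" using gu(1) perm_group_comp[OF G] by auto
      then show ?thesis unfolding s by blast
    qed
    have "O' \<inter> T \<noteq> {}"
    proof
      assume disj: "O' \<inter> T = {}"
      \<comment> \<open>The permutation may depend on \<kappa>, since different points use different
        bricks of one generator. The condition survives composition because elements of
        \<open>G\<close> preserve the orbit.\<close>
      let ?H = "{h :: ('s \<Rightarrow> cantor) \<Rightarrow> 's \<Rightarrow> cantor. bij h \<and> (\<forall>\<kappa>. \<exists>g\<in>G. \<forall>u\<in>O'. h \<kappa> u = \<kappa> (g u))}"
      have "perm_group ?H"
        unfolding perm_group_def
      proof (intro conjI ballI)
        show "id \<in> ?H" using perm_group_id[OF G] by (auto intro: bexI[of _ id])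
      next
        fix h assume "h \<in> ?H"
        then show "bij h" by blast
      next
        fix h assume h: "h \<in> ?H"
        have "\<exists>g\<in>G. \<forall>u\<in>O'. finv h \<kappa> u = \<kappa> (g u)" for \<kappa>
        proof -
          obtain g where g: "g \<in> G" "\<forall>u\<in>O'. h (finv h \<kappa>) u = finv h \<kappa> (g u)" using h by blast
          have "finv h \<kappa> u = \<kappa> (finv g u)" if "u \<in> O'" for u
            using g inO[OF perm_group_inv[OF G g(1)] that] perm_group_bij[OF G g(1)] h by simp
          then show ?thesis using perm_group_inv[OF G g(1)] by blast
        qed
        then show "finv h \<in> ?H" using h by simp
      next
        fix h k assume hk: "h \<in> ?H" "k \<in> ?H"
        have "\<exists>g\<in>G. \<forall>u\<in>O'. (h \<circ> k) \<kappa> u = \<kappa> (g u)" for \<kappa>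
        proof -
          obtain g where g: "g \<in> G" "\<forall>u\<in>O'. h (k \<kappa>) u = k \<kappa> (g u)" using hk(1) by blast
          obtain g' where g': "g' \<in> G" "\<forall>u\<in>O'. k \<kappa> u = \<kappa> (g' u)" using hk(2) by blast
          show ?thesis
            using g g' inO perm_group_comp[OF G g'(1) g(1)] by (intro bexI[of _ "g' \<circ> g"]) simp_all
        qed
        then show "h \<circ> k \<in> ?H" using hk by (simp add: bij_comp)
      qed
      moreover have "F \<subseteq> ?H"
      proof
        fix h assume h: "h \<in> F"
        have "\<exists>g\<in>G. \<forall>u\<in>O'. h \<kappa> u = \<kappa> (g u)" for \<kappa>
        proof -
          obtain \<phi> \<psi> \<gamma> where *: "(\<phi>, \<psi>, \<gamma>) \<in> D h" "\<kappa> \<in> brick \<phi>" using D3[OF h] by blast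
          note data = D2[OF h *(1)]
          have \<gamma>: "finv \<gamma> \<in> G" using data perm_group_inv[OF G] by blast
          obtain x where x: "\<kappa> = Phi \<phi> x" using *(2) by (rule brickE)
          have "{s. \<phi> s \<noteq> []} \<union> {s. \<psi> s \<noteq> []} \<subseteq> T" using h *(1) unfolding T_def by blast
          \<comment> \<open>With both labels empty on the orbit, the twist only permutes coordinates
            there.\<close>
          then have nil: "\<phi> u = []" "\<psi> u = []" if "u \<in> O'" for u
            using that disj by blast+
          have "h \<kappa> u = \<kappa> (finv \<gamma> u)" if "u \<in> O'" for u
          proof -
            have "h \<kappa> = Phi \<psi> (tau \<gamma> x)" using data x realizesD by metis
            then have "h \<kappa> u = x (finv \<gamma> u)"
              using nil(2)[OF that] by (simp add: Phi_def tau_def)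
            also have "\<dots> = \<kappa> (finv \<gamma> u)"
              using nil(1)[OF inO[OF \<gamma> that]] x by (simp add: Phi_def)
            finally show ?thesis .
          qed
          then show ?thesis using \<gamma> by blast
        qed
        then show "h \<in> ?H" using bF[OF h] by simp
      qed
      ultimately have sub: "SV G \<subseteq> ?H" unfolding F(3)[symmetric] by (rule gen_subset)
      \<comment> \<open>This flips the first bit at \<open>s\<close>. Permuting the coordinates of
        the constant False point cannot produce the True bit that appears.\<close>
      let ?f = "sw (single s [False]) (single s [True])"
      have d: "apart (single s [False]) (single s [True])" using apart_single[of s False] by simp
      have "?f \<in> SV G"
        using d by (simp add: SV_iff[OF G] bij_sw locally_twist_sw[OF G])
      with sub obtain g where g: "\<forall>u\<in>O'. ?f (\<lambda>_ _. False) u = (\<lambda>_ _. False) (g u)" by blast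
      have "(\<lambda>_ _. False) = Phi (single s [False]) (\<lambda>_ _. False)"
        by (auto simp: Phi_def single_def wcat_def fun_eq_iff)
      then have "?f (\<lambda>_ _. False) = Phi (single s [True]) (\<lambda>_ _. False)"
        using sw_Phi(1) by metis
      then have "?f (\<lambda>_ _. False) s 0"
        using in_brick_single_iff[of "Phi (single s [True]) (\<lambda>_ _. False)" s True] by simp
      moreover have "s \<in> O'" using s perm_group_id[OF G] by force
      ultimately show False using g by auto
    qed
    then obtain t where t: "t \<in> O'" "t \<in> T" by blast
    have "O' = {g t | g. g \<in> G}"
    proof
      show "{g t | g. g \<in> G} \<subseteq> O'" using inO t(1) by blast
      obtain k where k: "k \<in> G" "t = k s" using t(1) s by blast
      show "O' \<subseteq> {g t | g. g \<in> G}"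
      proof
        fix u assume "u \<in> O'"
        then obtain g where "g \<in> G" "u = g s" using s by blast
        then have "u = (g \<circ> finv k) t" "g \<circ> finv k \<in> G"
          using k perm_group_bij[OF G] perm_group_inv[OF G] perm_group_comp[OF G] by simp_all
        then show "u \<in> {g t | g. g \<in> G}" by blast
      qed
    qed
    then show "O' \<in> (\<lambda>t. {g t | g. g \<in> G}) ` T" using t(2) by blast
  qed
  then have "finite (orbits G)" using T finite_surj by blast
  with 1 show ?thesis ..
qed

theorem theoremA:
  fixes G :: "('s \<Rightarrow> 's) set"
  assumes "subgroup G (BijGroup (UNIV :: 's set))"
  shows "fin_gen_perm (SV G) \<longleftrightarrow> fin_gen_perm G \<and> finite (orbits G)"
proof
  have G: "perm_group G" using assms by (simp add: subgroup_BijGroup_iff)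
  {
    assume "fin_gen_perm (SV G)"
    then show "fin_gen_perm G \<and> finite (orbits G)" by (rule fin_gen_SV_necessary[OF G])
  next
    assume *: "fin_gen_perm G \<and> finite (orbits G)"
    then obtain A where A: "finite A" "A \<subseteq> G" "gen A = G" by (auto simp: fin_gen_perm_def)
    \<comment> \<open>One representative per orbit gives a finite set meeting every orbit.\<close>
    define pick :: "'s set \<Rightarrow> 's" where "pick X = (SOME x. x \<in> X)" for X
    have "\<exists>\<gamma>\<in>G. \<gamma> s \<in> pick ` orbits G" for s
    proof -
      let ?X = "{g s | g. g \<in> G}"
      have "id s \<in> ?X" using perm_group_id[OF G] by blast
      then have "pick ?X \<in> ?X" unfolding pick_def by (rule someI)
      moreover have "pick ?X \<in> pick ` orbits G" by (auto simp: orbits_def)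
      ultimately show ?thesis by force
    qed
    \<comment> \<open>Any coordinate can serve as \<open>r\<close>, so \<open>undefined\<close> is
      taken.\<close>
    then interpret sv_generators G A "pick ` orbits G" undefined
      using G A * by unfold_locales simp_all
    show "fin_gen_perm (SV G)" by (rule fin_gen_SV)
  }
qed

end
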